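(* Let $s \geq 2$. For each $i \in \{1,\dots,s\}$ let $h_i \geq 1$ and let $q_{i,1},\dots,q_{i,h_i} \geq 2$ be integers, such that $\gcd(q_{i,k},q_{j,l})=1$ whenever $i \neq j$. For each $i$ let $\mathcal{P}_i=(p_{i,1},p_{i,2},\dots)$ be an arbitrary sequence with $p_{i,j} \in \{q_{i,1},\dots,q_{i,h_i}\}$ for all $j \geq 1$, and let $\Sigma_i=(\sigma_{i,j})_{j\ge1}$ be an arbitrary sequence where each $\sigma_{i,j}$ is a permutation of $\{0,1,\dots,p_{i,j}-1\}$. Let $H_{\boldsymbol{\mathcal{P}}}^{\mathbf{S}}(n,\mathbf{x})$ denote the generalized Halton sequence defined in the context. Put $h_0=\max_i h_i$, $q_0=\max_{i,j} q_{i,j}$, $C_1 = 2s h_0 q_0^{s}\log_2 q_0$ and $C = 2^{s+3} s^s h_0^s q_0^{s^2}\log_2^s q_0$. Then for every integer $N$ with $\log_2 N \geq 2 q_0^{s-1} C_1$, $$\inf_{\mathbf{x}\in[0,1)^s}\ \max_{1\le M\le N} M\, D^{*}\big((H_{\boldsymbol{\mathcal{P}}}^{\mathbf{S}}(n,\mathbf{x}))_{n=1}^{M}\big) \;\geq\; C^{-1}\log_2^s N .$$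
   Context: Star discrepancy: for points $\beta_1,\dots,\beta_N \in [0,1)^s$ and $\mathbf{y}=(y_1,\dots,y_s)\in(0,1]^s$, let $B_{\mathbf{y}}=[0,y_1)\times\cdots\times[0,y_s)$ and $\Delta(B_{\mathbf{y}},(\beta_n)_{n=1}^N)=\sum_{n=1}^N(\mathbf{1}_{B_{\mathbf{y}}}(\beta_n)-y_1\cdots y_s)$; then $D^*((\beta_n)_{n=1}^N)=\sup_{0<y_1,\dots,y_s\le 1}|\Delta(B_{\mathbf{y}},(\beta_n)_{n=1}^N)/N|$. Cantor expansion and odometer: for a sequence of integers $Q=(q_1,q_2,\dots)$ with $q_j\ge2$, put $Q_j=q_1\cdots q_j$. Every $x\in[0,1)$ has a unique expansion $x=\sum_{j\ge1}x_j/Q_j$ with $x_j\in\{0,\dots,q_j-1\}$ and $x_j\neq q_j-1$ for infinitely many $j$. The odometer transform is $T_Q(x)=(x_k+1)/Q_k+\sum_{j\ge k+1}x_j/Q_j$, where $k=\min\{j: x_j\neq q_j-1\}$; $T_Q^0(x)=x$ and $T_Q^n=T_Q\circ T_Q^{n-1}$. Generalized Halton sequence: with $\tilde P_{i,j}=\prod_{k=1}^j p_{i,k}$, let $T_{\boldsymbol{\mathcal{P}}}(\mathbf{x})=(T_{\mathcal{P}_1}(x_1),\dots,T_{\mathcal{P}_s}(x_s))$ for $\mathbf{x}=(x_1,\dots,x_s)\in[0,1)^s$ (each $T_{\mathcal{P}_i}$ being the odometer for the sequence $\mathcal{P}_i$). For $x_i=\sum_{j\ge1}x_{i,j}/\tilde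 P_{i,j}$ (Cantor expansion with respect to $\mathcal{P}_i$) define $\tilde\Sigma_i(x_i)=\sum_{j\ge1}\sigma_{i,j}(x_{i,j})/\tilde P_{i,j}$ and $\tilde{\mathbf{S}}(\mathbf{x})=(\tilde\Sigma_1(x_1),\dots,\tilde\Sigma_s(x_s))$. Then $H_{\boldsymbol{\mathcal{P}}}^{\mathbf{S}}(n,\mathbf{x})=\tilde{\mathbf{S}}(T_{\boldsymbol{\mathcal{P}}}^n(\mathbf{x}))$ for $n=0,1,2,\dots$. *)

theory Defs
  imports "HOL-Analysis.Analysis"
begin

text \<open>Sequences are indexed from 1; the value at index 0 of a base sequence is never used.\<close>

definition cantor_prod :: "(nat \<Rightarrow> nat) \<Rightarrow> nat \<Rightarrow> nat" where
  "cantor_prod q j = (\<Prod>k = 1..j. q k)"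

text \<open>The condition \<open>d 0 = 0\<close> only fixes the unused entry, so that the digit sequence
  is unique as a function on the naturals.\<close>

definition is_cantor_expansion :: "(nat \<Rightarrow> nat) \<Rightarrow> real \<Rightarrow> (nat \<Rightarrow> nat) \<Rightarrow> bool" where
  "is_cantor_expansion q x d \<longleftrightarrow>
     d 0 = 0 \<and> (\<forall>j\<ge>1. d j \<in> {0..q j - 1}) \<and> infinite {j. j \<ge> 1 \<and> d j \<noteq> q j - 1} \<and>
     (\<lambda>j. real (d (Suc j)) / real (cantor_prod q (Suc j))) sums x"

text \<open>Meaningful for \<open>x\<close> in \<open>[0,1)\<close> and bases \<open>q j \<ge> 2\<close>, where the expansion exists and is unique.\<close>

definition cantor_digits :: "(nat \<Rightarrow> nat) \<Rightarrow> real \<Rightarrow> nat \<Rightarrow> nat" where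
  "cantor_digits q x = (THE d. is_cantor_expansion q x d)"

definition odometer :: "(nat \<Rightarrow> nat) \<Rightarrow> real \<Rightarrow> real" where
  "odometer q x =
     (let d = cantor_digits q x;
          k = (LEAST j. j \<ge> 1 \<and> d j \<noteq> q j - 1)
      in (real (d k) + 1) / real (cantor_prod q k) +
         (\<Sum>j. real (d (j + (k + 1))) / real (cantor_prod q (j + (k + 1)))))"

definition odometer_vec :: "('d \<Rightarrow> nat \<Rightarrow> nat) \<Rightarrow> real ^ 'd \<Rightarrow> real ^ 'd::finite" where
  "odometer_vec p x = (\<chi> i. odometer (p i) (x $ i))"

definition digit_scramble :: "(nat \<Rightarrow> nat) \<Rightarrow> (nat \<Rightarrow> nat \<Rightarrow> nat) \<Rightarrow> real \<Rightarrow> real" where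
  "digit_scramble q \<sigma> x =
     (\<Sum>j. real (\<sigma> (Suc j) (cantor_digits q x (Suc j))) / real (cantor_prod q (Suc j)))"

definition digit_scramble_vec ::
  "('d \<Rightarrow> nat \<Rightarrow> nat) \<Rightarrow> ('d \<Rightarrow> nat \<Rightarrow> nat \<Rightarrow> nat) \<Rightarrow> real ^ 'd \<Rightarrow> real ^ 'd::finite" where
  "digit_scramble_vec p \<sigma> x = (\<chi> i. digit_scramble (p i) (\<sigma> i) (x $ i))"

definition halton ::
  "('d \<Rightarrow> nat \<Rightarrow> nat) \<Rightarrow> ('d \<Rightarrow> nat \<Rightarrow> nat \<Rightarrow> nat) \<Rightarrow> nat \<Rightarrow> real ^ 'd \<Rightarrow> real ^ 'd::finite" where
  "halton p \<sigma> n x = digit_scramble_vec p \<sigma> ((odometer_vec p ^^ n) x)"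

definition anchored_box :: "real ^ 'd \<Rightarrow> (real ^ 'd::finite) set" where
  "anchored_box y = {z. \<forall>i. z $ i \<in> {0..<y $ i}}"

definition local_discrepancy :: "real ^ 'd \<Rightarrow> (nat \<Rightarrow> real ^ 'd::finite) \<Rightarrow> nat \<Rightarrow> real" where
  "local_discrepancy y \<beta> N = (\<Sum>n = 1..N. indicator (anchored_box y) (\<beta> n) - (\<Prod>i\<in>UNIV. y $ i))"

definition star_discrepancy :: "(nat \<Rightarrow> real ^ 'd::finite) \<Rightarrow> nat \<Rightarrow> real" where
  "star_discrepancy \<beta> N =
     (SUP y\<in>{y. \<forall>i. y $ i \<in> {0<..1}}. \<bar>local_discrepancy y \<beta> N / real N\<bar>)"

definition unit_cube :: "(real ^ 'd::finite) set" where
  "unit_cube = {x. \<forall>i. x $ i \<in> {0..<1}}"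

end

theory Submission
  imports Defs "HOL-Number_Theory.Cong"
begin

text \<open>
  Fix sets \<open>S\<^sub>i\<close> of digit positions and let \<open>y\<^sub>i = \<Sum>j\<in>S\<^sub>i. 1 / P\<^sub>i\<^sub>,\<^sub>j\<close>. The box below \<open>y\<close> is the
  disjoint union over \<open>k \<in> \<Prod>S\<^sub>i\<close> of elementary boxes, and each of them is hit exactly when the
  time \<open>n\<close> lies in a residue class modulo \<open>P\<^sub>k = \<Prod>P\<^sub>i\<^sub>,\<^sub>k\<^sub>i\<close>. By the Chinese remainder theorem there is a
  time \<open>M\<^sub>0\<close> at which the orbit agrees with the digits of \<open>y\<close> in every coordinate; counting time from \<open>M\<^sub>0\<close>, all
  lower digits cancel and the residue of box \<open>k\<close> is \<open>A\<^sub>k = r\<^sub>k P\<^sub>k / Q\<close>, where \<open>Q\<close> is the product of the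
  bases at the positions \<open>k\<^sub>i\<close>. Averaging the discrepancy over a full period, box \<open>k\<close> contributes
  \<open>1/2 - r\<^sub>k/Q + 1/(2P\<^sub>k)\<close>.

  By the pigeonhole principle the positions can be restricted so that the bases and the residues
  of the products \<open>P\<^sub>i\<^sub>,\<^sub>j\<close> modulo the other bases are constant. Then \<open>r\<^sub>k\<close> depends only on the
  differences \<open>\<sigma>\<^sup>-\<^sup>1(0) - \<sigma>\<^sup>-\<^sup>1(1)\<close> at the positions \<open>k\<^sub>i\<close>; none of these vanishes modulo its base,
  so that \<open>r\<^sub>k/Q \<noteq> 1/2\<close> as soon as there are two coordinates. A suitable choice of \<open>S\<^sub>i\<close> makes all
  contributions have the same sign, and their number is of order \<open>log\<^sup>s N\<close>.
\<close>

section \<open>Cantor expansions\<close>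

lemma infinite_nat_exceeds: "infinite {j::nat. R j} \<Longrightarrow> \<exists>l>m. R l"
  by (auto simp: infinite_nat_iff_unbounded)

locale cantor_base =
  fixes q :: "nat \<Rightarrow> nat"
  assumes base_ge_2: "j \<ge> 1 \<Longrightarrow> q j \<ge> 2"
begin

abbreviation P :: "nat \<Rightarrow> nat" where
  "P \<equiv> cantor_prod q"

definition digit_seq :: "(nat \<Rightarrow> nat) \<Rightarrow> bool" where
  "digit_seq e \<longleftrightarrow> (\<forall>j\<ge>1. e j < q j)"

definition tail :: "(nat \<Rightarrow> nat) \<Rightarrow> nat \<Rightarrow> real" where
  "tail e j = (\<Sum>l. real (e (l + Suc j)) / real (P (l + Suc j)))"

lemma P_0 [simp]: "P 0 = 1"
  by (simp add: cantor_prod_def)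

lemma P_Suc: "P (Suc j) = P j * q (Suc j)"
  by (simp add: cantor_prod_def)

lemma P_ge: "2 ^ j \<le> P j"
proof (induction j)
  case (Suc j)
  then show ?case
    using base_ge_2[of "Suc j"] mult_le_mono[OF Suc, of 2 "q (Suc j)"] by (simp add: P_Suc mult.commute)
qed simp

lemma P_pos [simp]: "P j > 0"
  using P_ge[of j] by (metis less_le_trans pos2 zero_less_power)

lemma P_dvd: "i \<le> j \<Longrightarrow> P i dvd P j"
  by (induction rule: dec_induct) (auto simp: P_Suc)

lemma inverse_P_tendsto_0: "(\<lambda>j. 1 / real (P j)) \<longlonglongrightarrow> 0"
proof (rule tendsto_sandwich[where f = "\<lambda>_. 0" and h = "\<lambda>j. (1/2) ^ j"])
  show "\<forall>\<^sub>F j in sequentially. 1 / real (P j) \<le> (1/2) ^ j"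
  proof (intro always_eventually allI)
    fix j
    have "(2::real) ^ j \<le> real (P j)"
      using P_ge[of j] by (metis of_nat_le_iff of_nat_numeral of_nat_power)
    then show "1 / real (P j) \<le> (1/2) ^ j"
      by (simp add: power_one_over frac_le)
  qed
  show "(\<lambda>j. (1/2::real) ^ j) \<longlonglongrightarrow> 0"
    by (intro LIMSEQ_power_zero) auto
qed auto

text \<open>The largest digit \<open>q (Suc j) - 1\<close> gives equality, so all bounds on tails
  reduce to one telescoping series.\<close>

lemma digit_over_P_le:
  assumes "digit_seq e"
  shows "real (e (Suc j)) / real (P (Suc j)) \<le> 1 / real (P j) - 1 / real (P (Suc j))"
proof -
  have "real (e (Suc j)) \<le> real (q (Suc j)) - 1"
    using assms unfolding digit_seq_def by (metis Suc_leI le_add1 of_nat_1 of_nat_Suc of_nat_le_iff plus_1_eq_Suc le_diff_eq add.commute)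
  then have "real (e (Suc j)) / real (P (Suc j)) \<le> (real (q (Suc j)) - 1) / real (P (Suc j))"
    by (intro divide_right_mono) auto
  also have "\<dots> = 1 / real (P j) - 1 / real (P (Suc j))"
    using base_ge_2[of "Suc j"] by (simp add: P_Suc field_simps)
  finally show ?thesis .
qed

lemma telescope_P: "(\<lambda>l. 1 / real (P (l + j)) - 1 / real (P (l + Suc j))) sums (1 / real (P j))"
  using telescope_sums'[OF LIMSEQ_ignore_initial_segment[OF inverse_P_tendsto_0, of j]] by simp

lemma summable_digits:
  assumes "digit_seq e"
  shows "summable (\<lambda>l. real (e (l + Suc j)) / real (P (l + Suc j)))"
proof (rule summable_comparison_test'[OF sums_summable[OF telescope_P[of j]]])
  show "norm (real (e (n + Suc j)) / real (P (n + Suc j))) \<le> 1 / real (P (n + j)) - 1 / real (P (n + Suc j))" for n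
    using digit_over_P_le[OF assms, of "n + j"] by simp
qed

lemma tail_nonneg: "digit_seq e \<Longrightarrow> 0 \<le> tail e j"
  unfolding tail_def by (intro suminf_nonneg summable_digits) auto

lemma tail_Suc:
  assumes "digit_seq e"
  shows "tail e j = real (e (Suc j)) / real (P (Suc j)) + tail e (Suc j)"
  using suminf_split_head[OF summable_digits[OF assms, of j]] by (simp add: tail_def)

lemma tail_le: "digit_seq e \<Longrightarrow> tail e j \<le> 1 / real (P j)"
  unfolding tail_def
  using suminf_le[OF _ summable_digits[of e j] sums_summable[OF telescope_P[of j]]]
    digit_over_P_le[of e] sums_unique[OF telescope_P[of j]] by simp

text \<open>Position \<open>l\<close> falls short of the telescoping bound. Induction on the
  distance from \<open>j\<close> to \<open>l\<close> carries this strictness down, the intermediate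
  positions needing only the nonstrict bound.\<close>

lemma tail_less:
  assumes e: "digit_seq e" and l: "l > j" "e l \<noteq> q l - 1"
  shows "tail e j < 1 / real (P j)"
  using l
proof (induction "l - Suc j" arbitrary: j)
  case 0
  then have [simp]: "l = Suc j" by simp
  have "real (e l) + 1 < real (q l)"
    using e 0 unfolding digit_seq_def by (metis Suc_lessI \<open>l = Suc j\<close> add_diff_cancel_left' le_add1 of_nat_Suc of_nat_less_iff plus_1_eq_Suc add.commute)
  then have "(real (e l) + 1) / P l < q l / real (P l)"
    by (intro divide_strict_right_mono) auto
  also have "\<dots> = 1 / real (P j)"
    using base_ge_2[of l] by (simp add: P_Suc)
  finally show ?case
    using tail_Suc[OF e, of j] tail_le[OF e, of l] by (simp add: add_divide_distrib)
next
  case (Suc n)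
  have "tail e (Suc j) < 1 / real (P (Suc j))"
    using Suc by (intro Suc(1)) (auto intro: Suc_lessI)
  then show ?case
    using tail_Suc[OF e, of j] digit_over_P_le[OF e, of j] by simp
qed

lemma tail_max:
  assumes "\<And>l. l > j \<Longrightarrow> e l = q l - 1"
  shows "tail e j = 1 / real (P j)"
proof -
  have "real (e (l + Suc j)) / real (P (l + Suc j)) = 1 / real (P (l + j)) - 1 / real (P (l + Suc j))" for l
    using base_ge_2[of "l + Suc j"] assms[of "l + Suc j"] by (simp add: P_Suc field_simps of_nat_diff)
  then show ?thesis
    unfolding tail_def using sums_unique[OF telescope_P[of j]] by simp
qed

lemma tail_0_eq:
  assumes "digit_seq e"
  shows "tail e 0 = (\<Sum>l=1..j. real (e l) / real (P l)) + tail e j"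
proof (induction j)
  case (Suc j)
  then show ?case using tail_Suc[OF assms, of j] by simp
qed simp

lemma tail_diff_at:
  assumes "digit_seq e" "digit_seq f" "j \<ge> 1" "\<And>l. l \<in> {1..<j} \<Longrightarrow> e l = f l"
  shows "tail f 0 - tail e 0 = (real (f j) - real (e j)) / real (P j) + tail f j - tail e j"
proof -
  obtain i where i: "j = Suc i" using assms(3) by (cases j) auto
  have "(\<Sum>l=1..i. real (e l) / real (P l)) = (\<Sum>l=1..i. real (f l) / real (P l))"
    using assms(4) i by (intro sum.cong) auto
  then show ?thesis
    using tail_0_eq[OF assms(1), of j] tail_0_eq[OF assms(2), of j] i by (simp add: diff_divide_distrib)
qed

text \<open>At the first difference the digits contribute at least \<open>1 / P j\<close>, while
  either tail lies between 0 and \<open>1 / P j\<close>. Both tails are kept in the inequality so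
  that the strict and the nonstrict comparison can be read off from it.\<close>

lemma tail_lex_le:
  assumes "digit_seq e" "digit_seq f" "j \<ge> 1" "\<And>l. l \<in> {1..<j} \<Longrightarrow> e l = f l" "e j < f j"
  shows "tail e 0 + tail f j + 1 / real (P j) \<le> tail f 0 + tail e j"
proof -
  have "1 / real (P j) \<le> (real (f j) - real (e j)) / real (P j)"
    using assms(5) by (intro divide_right_mono) auto
  then show ?thesis using tail_diff_at[OF assms(1-4)] by simp
qed

lemma lex_le:
  assumes "digit_seq e" "digit_seq f" "j \<ge> 1" "\<And>l. l \<in> {1..<j} \<Longrightarrow> e l = f l" "e j < f j"
  shows "tail e 0 \<le> tail f 0"
  using tail_lex_le[OF assms] tail_le[OF assms(1), of j] tail_nonneg[OF assms(2), of j] by linarith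

lemma lex_less:
  assumes "digit_seq e" "digit_seq f" "j \<ge> 1" "\<And>l. l \<in> {1..<j} \<Longrightarrow> e l = f l" "e j < f j"
    and "infinite {j. e j \<noteq> q j - 1}"
  shows "tail e 0 < tail f 0"
proof -
  obtain l where "l > j" "e l \<noteq> q l - 1"
    using infinite_nat_exceeds[OF assms(6)] by blast
  then show ?thesis
    using tail_lex_le[OF assms(1-5)] tail_less[OF assms(1), of j l] tail_nonneg[OF assms(2), of j] by linarith
qed

lemma first_difference:
  assumes "e j \<noteq> f j" "j \<ge> (1::nat)"
  obtains k where "k \<ge> 1" "e k \<noteq> f k" "\<And>l. l \<in> {1..<k} \<Longrightarrow> e l = f l"
proof -
  define k where "k = (LEAST k. k \<ge> 1 \<and> e k \<noteq> f k)"
  have "k \<ge> 1 \<and> e k \<noteq> f k"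
    unfolding k_def using assms by (intro LeastI[of "\<lambda>k. k \<ge> 1 \<and> e k \<noteq> f k" j]) auto
  moreover have "e l = f l" if "l \<in> {1..<k}" for l
    using not_less_Least[of l "\<lambda>k. k \<ge> 1 \<and> e k \<noteq> f k"] that unfolding k_def by auto
  ultimately show ?thesis using that by blast
qed

lemma expansion_iff:
  "is_cantor_expansion q x d \<longleftrightarrow>
     d 0 = 0 \<and> digit_seq d \<and> infinite {j. d j \<noteq> q j - 1} \<and> x = tail d 0"
proof -
  have "infinite {j. j \<ge> 1 \<and> d j \<noteq> q j - 1} \<longleftrightarrow> infinite {j. d j \<noteq> q j - 1}"
  proof -
    have "{j. d j \<noteq> q j - 1} \<subseteq> insert 0 {j. j \<ge> 1 \<and> d j \<noteq> q j - 1}"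
      by (auto simp: Suc_le_eq)
    moreover have "{j. j \<ge> 1 \<and> d j \<noteq> q j - 1} \<subseteq> {j. d j \<noteq> q j - 1}" by auto
    ultimately show ?thesis by (meson finite_insert finite_subset)
  qed
  moreover have "(\<forall>j\<ge>1. d j \<in> {0..q j - 1}) \<longleftrightarrow> digit_seq d"
  proof -
    have "d j \<in> {0..q j - 1} \<longleftrightarrow> d j < q j" if "j \<ge> 1" for j
      using base_ge_2[OF that] by auto
    then show ?thesis unfolding digit_seq_def by blast
  qed
  moreover have "(\<lambda>j. real (d (Suc j)) / real (P (Suc j))) sums x \<longleftrightarrow> x = tail d 0" if "digit_seq d"
    using summable_digits[OF that, of 0] by (auto simp: tail_def sums_iff)
  ultimately show ?thesis unfolding is_cantor_expansion_def by blast
qed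

lemma expansion_unique:
  assumes d: "is_cantor_expansion q x d" and f: "is_cantor_expansion q x f"
  shows "d = f"
proof (rule ccontr)
  assume "d \<noteq> f"
  then obtain j where j: "d j \<noteq> f j" by auto
  with d f have "j \<ge> 1" unfolding expansion_iff by (cases j) auto
  with j obtain k where k: "k \<ge> 1" "d k \<noteq> f k" "\<And>l. l \<in> {1..<k} \<Longrightarrow> d l = f l"
    by (rule first_difference) auto
  have df: "digit_seq d" "digit_seq f" "infinite {j. d j \<noteq> q j - 1}" "infinite {j. f j \<noteq> q j - 1}"
    "tail d 0 = tail f 0"
    using d f unfolding expansion_iff by auto
  from k(2) consider "d k < f k" | "f k < d k" by linarith
  then show False
  proof cases
    case 1
    then show False using lex_less[OF df(1,2) k(1,3) _ df(3)] df(5) by simp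
  next
    case 2
    then show False using lex_less[OF df(2,1) k(1) k(3)[symmetric] _ df(4)] df(5) by simp
  qed
qed

text \<open>The digits come from the integer parts \<open>F j\<close> of \<open>x * P j\<close>:
  since \<open>F (Suc j) div q (Suc j) = F j\<close>, the partial sums are \<open>F j / P j\<close>
  and converge to \<open>x\<close>. An eventually maximal digit sequence would give
  \<open>x = (F j + 1) / P j\<close>, against the choice of the integer part.\<close>

lemma expansion_exists:
  assumes "x \<in> {0..<1}"
  shows "\<exists>d. is_cantor_expansion q x d"
proof -
  define F where "F j = nat \<lfloor>x * real (P j)\<rfloor>" for j
  define d where "d j = (if j = 0 then 0 else F j mod q j)" for j
  have F: "real (F j) \<le> x * real (P j)" "x * real (P j) < real (F j) + 1" for j
    unfolding F_def using assms by (auto simp: of_nat_nat)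
  have F_div: "F (Suc j) div q (Suc j) = F j" for j
  proof -
    define b where "b = q (Suc j)"
    have b: "b > 0" using base_ge_2[of "Suc j"] by (simp add: b_def)
    have "nat \<lfloor>x * real (P j) * real b\<rfloor> div b = nat (\<lfloor>x * real (P j) * real b\<rfloor> div int b)"
      using assms by (simp add: nat_div_distrib)
    also have "\<lfloor>x * real (P j) * real b\<rfloor> div int b = \<lfloor>x * real (P j) * real b / real_of_int (int b)\<rfloor>"
      by (subst floor_divide_real_eq_div) auto
    also have "\<dots> = \<lfloor>x * real (P j)\<rfloor>" using b by simp
    finally show ?thesis by (simp add: F_def P_Suc b_def mult.assoc)
  qed
  have ds: "digit_seq d"
    using base_ge_2 by (auto simp: digit_seq_def d_def) (metis base_ge_2 less_le_trans mod_less_divisor One_nat_def pos2)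
  have F_Suc: "F (Suc j) = F j * q (Suc j) + d (Suc j)" for j
    using F_div[of j] by (simp add: d_def) (metis div_mult_mod_eq)
  have part: "(\<Sum>l=1..j. real (d l) / real (P l)) = real (F j) / real (P j)" for j
  proof (induction j)
    case 0
    show ?case using assms by (simp add: F_def)
  next
    case (Suc j)
    have "real (F j) / real (P j) + real (d (Suc j)) / real (P (Suc j)) = real (F (Suc j)) / real (P (Suc j))"
      using base_ge_2[of "Suc j"] by (simp add: F_Suc P_Suc field_simps)
    then show ?case using Suc by simp
  qed
  have "(\<lambda>j. real (F j) / real (P j)) \<longlonglongrightarrow> x"
  proof (rule tendsto_sandwich)
    show "\<forall>\<^sub>F j in sequentially. x - 1 / real (P j) \<le> real (F j) / real (P j)"
    proof (intro always_eventually allI)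
      fix j
      have "x \<le> (real (F j) + 1) / real (P j)"
        using F(2)[of j] by (simp add: pos_le_divide_eq)
      then show "x - 1 / real (P j) \<le> real (F j) / real (P j)"
        by (simp add: add_divide_distrib)
    qed
    show "\<forall>\<^sub>F j in sequentially. real (F j) / real (P j) \<le> x"
      using F(1) by (simp add: pos_divide_le_eq)
    show "(\<lambda>j. x - 1 / real (P j)) \<longlonglongrightarrow> x"
      using tendsto_diff[OF tendsto_const inverse_P_tendsto_0, of x] by simp
  qed auto
  moreover have "(\<lambda>j. \<Sum>l<j. real (d (Suc l)) / real (P (Suc l))) = (\<lambda>j. real (F j) / real (P j))"
    unfolding part[symmetric] by (intro ext sum.reindex_bij_witness[of _ "\<lambda>l. l - 1" Suc]) auto
  ultimately have "(\<lambda>l. real (d (Suc l)) / real (P (Suc l))) sums x"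
    unfolding sums_def by simp
  then have x: "x = tail d 0" unfolding tail_def by (simp add: sums_iff)
  have "infinite {j. d j \<noteq> q j - 1}"
  proof
    assume "finite {j. d j \<noteq> q j - 1}"
    then obtain j where j: "\<And>l. l > j \<Longrightarrow> d l = q l - 1"
      unfolding finite_nat_set_iff_bounded_le by (metis (mono_tags, lifting) mem_Collect_eq not_le)
    have "x = (real (F j) + 1) / real (P j)"
      using tail_0_eq[OF ds, of j] tail_max[of j d] j part x by (simp add: add_divide_distrib)
    then show False using F(2)[of j] by simp
  qed
  then show ?thesis using ds x unfolding expansion_iff by (intro exI[of _ d]) (auto simp: d_def)
qed

lemma cantor_digits_eq: "is_cantor_expansion q x d \<Longrightarrow> cantor_digits q x = d"
  unfolding cantor_digits_def by (rule the_equality) (auto dest: expansion_unique)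

lemma cantor_digits_expansion: "x \<in> {0..<1} \<Longrightarrow> is_cantor_expansion q x (cantor_digits q x)"
  using expansion_exists[of x] by (auto simp: cantor_digits_eq)

lemma expansion_in_unit:
  assumes "is_cantor_expansion q x d"
  shows "x \<in> {0..<1}"
proof -
  have d: "digit_seq d" "infinite {j. d j \<noteq> q j - 1}" "x = tail d 0"
    using assms unfolding expansion_iff by auto
  obtain l where "l > 0" "d l \<noteq> q l - 1"
    using infinite_nat_exceeds[OF d(2)] by blast
  then show ?thesis
    using d tail_less[of d 0 l] tail_nonneg[of d 0] by simp
qed

text \<open>The odometer adds one to this number modulo \<open>P J\<close>.\<close>

definition num :: "(nat \<Rightarrow> nat) \<Rightarrow> nat \<Rightarrow> nat" where
  "num d J = (\<Sum>j=1..J. d j * P (j - 1))"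

lemma num_0 [simp]: "num d 0 = 0"
  and num_Suc: "num d (Suc J) = num d J + d (Suc J) * P J"
  by (auto simp: num_def)

lemma num_less: "digit_seq d \<Longrightarrow> num d J < P J"
proof (induction J)
  case (Suc J)
  have "d (Suc J) + 1 \<le> q (Suc J)" using Suc.prems by (auto simp: digit_seq_def Suc_le_eq)
  then have "(d (Suc J) + 1) * P J \<le> q (Suc J) * P J" by (intro mult_le_mono1)
  then show ?case using Suc by (simp add: num_Suc P_Suc algebra_simps)
qed simp

text \<open>Uniqueness of mixed radix representation: dividing by \<open>P J\<close> separates the
  top digit from the lower ones.\<close>

lemma num_eq_iff:
  assumes "digit_seq d" "digit_seq f"
  shows "num d J = num f J \<longleftrightarrow> (\<forall>j\<in>{1..J}. d j = f j)"
proof (induction J)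
  case (Suc J)
  have *: "num d (Suc J) div P J = d (Suc J)" "num f (Suc J) div P J = f (Suc J)"
    "num d (Suc J) mod P J = num d J" "num f (Suc J) mod P J = num f J"
    using num_less[OF assms(1), of J] num_less[OF assms(2), of J] by (auto simp: num_Suc)
  have "num d (Suc J) = num f (Suc J) \<longleftrightarrow> num d J = num f J \<and> d (Suc J) = f (Suc J)"
  proof
    assume "num d (Suc J) = num f (Suc J)"
    with * show "num d J = num f J \<and> d (Suc J) = f (Suc J)" by metis
  qed (simp add: num_Suc)
  then show ?case using Suc by (auto simp: le_Suc_eq)
qed simp

lemma num_cong_iff:
  assumes "digit_seq d" "digit_seq f"
  shows "[num d J = num f J] (mod P J) \<longleftrightarrow> (\<forall>j\<in>{1..J}. d j = f j)"
  using num_eq_iff[OF assms] num_less[OF assms(1)] num_less[OF assms(2)] by (simp add: cong_def)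

lemma num_cong_le: "j \<le> J \<Longrightarrow> [num d J = num d j] (mod P j)"
proof (induction rule: dec_induct)
  case (step n)
  have "[num d n + d (Suc n) * P n = num d j + 0] (mod P j)"
    using step P_dvd[of j n] by (intro cong_add) (auto simp: cong_0_iff)
  then show ?case by (simp add: num_Suc)
qed simp

lemma num_max:
  assumes "\<And>j. j \<in> {1..J} \<Longrightarrow> d j = q j - 1"
  shows "num d J + 1 = P J"
  using assms
proof (induction J)
  case (Suc J)
  have "num d J + 1 = P J" using Suc by simp
  moreover have "d (Suc J) + 1 = q (Suc J)" using Suc.prems[of "Suc J"] base_ge_2[of "Suc J"] by simp
  ultimately have "P (Suc J) = (num d J + 1) * (d (Suc J) + 1)" "P J = num d J + 1"
    by (simp_all add: P_Suc)
  then show ?case by (simp add: num_Suc algebra_simps)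
qed simp

text \<open>The new expansion \<open>f\<close> is that of \<open>x\<close> after a carry: zeros
  before \<open>k\<close>, one more at \<open>k\<close>, nothing changed behind. Hence addition of
  one modulo every \<open>P J\<close>, and, because only finitely many digits change, the eventual
  agreement on which the treatment of endpoints relies.\<close>

lemma odometer_digits:
  assumes x: "x \<in> {0..<1}"
  defines "d \<equiv> cantor_digits q x" and "d' \<equiv> cantor_digits q (odometer q x)"
  shows "odometer q x \<in> {0..<1}"
    and "[num d' J = num d J + 1] (mod P J)"
    and "\<forall>\<^sub>F j in sequentially. d' j = d j"
proof -
  define k where "k = (LEAST j. j \<ge> 1 \<and> d j \<noteq> q j - 1)"
  have d: "d 0 = 0" "digit_seq d" "infinite {j. d j \<noteq> q j - 1}" "x = tail d 0"
    using cantor_digits_expansion[OF x] unfolding expansion_iff d_def by auto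
  have "\<exists>j. j \<ge> 1 \<and> d j \<noteq> q j - 1"
    using infinite_nat_exceeds[OF d(3), of 0] by (auto simp: Suc_le_eq)
  from LeastI_ex[OF this] have k: "k \<ge> 1" "d k \<noteq> q k - 1" unfolding k_def by auto
  have less_k: "d j = q j - 1" if "j \<in> {1..<k}" for j
    using not_less_Least[of j "\<lambda>j. j \<ge> 1 \<and> d j \<noteq> q j - 1"] that unfolding k_def by auto
  define f where "f j = (if j < k then 0 else if j = k then d k + 1 else d j)" for j
  have "d k < q k" using d(2) k(1) by (simp add: digit_seq_def)
  then have dk: "d k + 1 < q k" using k(2) by simp
  have f: "digit_seq f"
    using d(2) dk base_ge_2 by (auto simp: digit_seq_def f_def)
  have ev: "\<forall>\<^sub>F j in sequentially. f j = d j"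
    unfolding eventually_sequentially by (intro exI[of _ "Suc k"]) (auto simp: f_def)
  have "infinite {j. f j \<noteq> q j - 1}"
  proof
    assume "finite {j. f j \<noteq> q j - 1}"
    moreover have "{j. d j \<noteq> q j - 1} \<subseteq> {j. f j \<noteq> q j - 1} \<union> {..k}"
      by (auto simp: f_def)
    ultimately show False using d(3) finite_subset by blast
  qed
  moreover have "odometer q x = tail f 0"
  proof -
    obtain k' where k': "k = Suc k'" using k(1) by (cases k) auto
    have "tail f k = (\<Sum>j. real (d (j + (k + 1))) / real (P (j + (k + 1))))"
      unfolding tail_def by (simp add: f_def)
    moreover have "(\<Sum>l=1..k'. real (f l) / real (P l)) = 0"
      by (intro sum.neutral) (auto simp: f_def k')
    ultimately show ?thesis
      unfolding odometer_def Let_def d_def[symmetric] k_def[symmetric]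
      using tail_0_eq[OF f, of k] by (simp add: k' f_def)
  qed
  moreover have "f 0 = 0" using k by (simp add: f_def)
  ultimately have exp: "is_cantor_expansion q (odometer q x) f"
    using f by (simp add: expansion_iff)
  then have d': "d' = f" unfolding d'_def by (rule cantor_digits_eq)
  show "odometer q x \<in> {0..<1}" using exp by (rule expansion_in_unit)
  show "\<forall>\<^sub>F j in sequentially. d' j = d j" using ev d' by simp
  show "[num d' J = num d J + 1] (mod P J)"
  \<comment> \<open>For \<open>J < k\<close> the carry leaves the first \<open>J\<close> digits:
    \<open>P J - 1\<close> becomes 0. Otherwise it stops inside them and the equation holds even
    without the modulus.\<close>
  proof (cases "J < k")
    case True
    have "num f J = 0" using True by (auto simp: num_def f_def)
    moreover have "num d J + 1 = P J" using True less_k by (intro num_max) auto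
    ultimately show ?thesis by (simp add: d' cong_def)
  next
    case False
    then have "k \<le> J" by simp
    then have "num f J = num d J + 1"
    proof (induction J rule: dec_induct)
      case base
      obtain k' where k': "k = Suc k'" using k(1) by (cases k) auto
      have "num f k' = 0" by (auto simp: num_def f_def k')
      moreover have "num d k' + 1 = P k'" using k' less_k by (intro num_max) auto
      ultimately show ?case by (simp add: k' num_Suc) (simp add: f_def k')
    next
      case (step n)
      then show ?case by (simp add: num_Suc) (simp add: f_def)
    qed
    then show ?thesis by (simp add: d')
  qed
qed

lemma odometer_iterate:
  assumes x: "x \<in> {0..<1}"
  shows "(odometer q ^^ n) x \<in> {0..<1}"
    and "[num (cantor_digits q ((odometer q ^^ n) x)) J = num (cantor_digits q x) J + n] (mod P J)"
    and "\<forall>\<^sub>F j in sequentially. cantor_digits q ((odometer q ^^ n) x) j = cantor_digits q x j"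
proof (induction n)
  case 0
  { case 1 show ?case using x by simp }
  { case 2 show ?case by simp }
  { case 3 show ?case by simp }
next
  case (Suc n)
  note step = odometer_digits[OF Suc(1)]
  { case 1 show ?case using step(1) by simp }
  { case 2 show ?case using cong_trans[OF step(2)[of J] cong_add[OF Suc(2) cong_refl[of 1]]] by simp }
  { case 3 show ?case using Suc(3) step(3) by eventually_elim simp }
qed

end

section \<open>Expansions with digits 0 and 1, and the lexicographic order relative to them\<close>

context cantor_base
begin

text \<open>The expansion of one coordinate of the corner of the test box. A digit 1 exceeds only
  the digit 0, so the interval below the corner splits into exactly one elementary interval for each
  element of \<open>S\<close>.\<close>

definition marks :: "nat set \<Rightarrow> nat \<Rightarrow> nat" where
  "marks S j = (if j \<in> S then 1 else 0)"

text \<open>Says that \<open>e\<close> precedes \<open>marks S\<close> lexicographically. For the values of the expansions this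
  is only almost the order of the reals, since an eventually maximal \<open>e\<close> may have the same value
  as \<open>marks S\<close>.\<close>

definition marked_below :: "nat set \<Rightarrow> (nat \<Rightarrow> nat) \<Rightarrow> bool" where
  "marked_below S e \<longleftrightarrow> (\<exists>j\<in>S. (\<forall>l\<in>{1..<j}. e l = marks S l) \<and> e j = 0)"

lemma digit_seq_marks: "digit_seq (marks S)"
  using base_ge_2 by (fastforce simp: digit_seq_def marks_def)

lemma marks_not_max:
  assumes "S \<subseteq> {1..n}" "j > n"
  shows "marks S j \<noteq> q j - 1"
  using assms base_ge_2[of j] by (auto simp: marks_def)

lemma infinite_marks_not_max:
  assumes "S \<subseteq> {1..n}"
  shows "infinite {j. marks S j \<noteq> q j - 1}"
  using marks_not_max[OF assms] unfolding infinite_nat_iff_unbounded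
  by (metis (mono_tags, lifting) lessI less_add_same_cancel1 mem_Collect_eq linorder_neqE_nat order.strict_trans)

lemma tail_marks:
  assumes "S \<subseteq> {1..n}"
  shows "tail (marks S) 0 = (\<Sum>j\<in>S. 1 / real (P j))"
proof -
  have "marks S (l + Suc n) = 0" for l
    using assms by (auto simp: marks_def)
  then have "tail (marks S) n = 0"
    by (simp add: tail_def)
  moreover have "(\<Sum>l=1..n. real (marks S l) / real (P l)) = (\<Sum>l\<in>S. 1 / real (P l))"
    using assms by (intro sum.mono_neutral_cong_right) (auto simp: marks_def)
  ultimately show ?thesis
    using tail_0_eq[OF digit_seq_marks, of S n] by simp
qed

lemma tail_marks_less_1:
  assumes "S \<subseteq> {1..n}"
  shows "(\<Sum>j\<in>S. 1 / real (P j)) < 1"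
  using tail_less[OF digit_seq_marks, of 0 "Suc n" S] marks_not_max[OF assms, of "Suc n"] tail_marks[OF assms]
  by simp

lemma tail_marks_pos:
  assumes "S \<subseteq> {1..n}" "S \<noteq> {}"
  shows "(\<Sum>j\<in>S. 1 / real (P j)) > 0"
  using assms finite_subset by (intro sum_pos) auto

text \<open>At the first difference the digit of \<open>e\<close> must be the larger one, for
  otherwise a mark would face the digit 0. The inequality is strict because \<open>marks S\<close>
  is not eventually maximal.\<close>

lemma not_marked_below:
  assumes e: "digit_seq e" and S: "S \<subseteq> {1..n}" and nb: "\<not> marked_below S e"
  shows "(\<forall>j\<ge>1. e j = marks S j) \<or> tail (marks S) 0 < tail e 0"
proof (rule disjCI)
  assume "\<not> tail (marks S) 0 < tail e 0"
  show "\<forall>j\<ge>1. e j = marks S j"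
  proof (rule ccontr)
    assume "\<not> (\<forall>j\<ge>1. e j = marks S j)"
    then obtain j where j: "marks S j \<noteq> e j" "j \<ge> 1" by metis
    then obtain k where k: "k \<ge> 1" "marks S k \<noteq> e k" "\<And>l. l \<in> {1..<k} \<Longrightarrow> marks S l = e l"
      by (rule first_difference) auto
    have "marks S k < e k"
    proof (rule ccontr)
      assume "\<not> marks S k < e k"
      then have "k \<in> S" "e k = 0"
        using k(2) by (auto simp: marks_def split: if_splits)
      then have "marked_below S e"
        unfolding marked_below_def using k(3) by (intro bexI[of _ k]) auto
      with nb show False by simp
    qed
    from lex_less[OF digit_seq_marks e k(1,3) this infinite_marks_not_max[OF S]]
    show False using \<open>\<not> tail (marks S) 0 < tail e 0\<close> by simp
  qed
qed

lemma marked_below_less_iff: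
  assumes e: "digit_seq e" and S: "S \<subseteq> {1..n}" and inf: "infinite {j. e j \<noteq> q j - 1}"
  shows "marked_below S e \<longleftrightarrow> tail e 0 < tail (marks S) 0"
proof
  assume "marked_below S e"
  then obtain j where j: "j \<in> S" "\<And>l. l \<in> {1..<j} \<Longrightarrow> e l = marks S l" "e j = 0"
    unfolding marked_below_def by blast
  with S have "j \<ge> 1" "e j < marks S j" by (auto simp: marks_def)
  then show "tail e 0 < tail (marks S) 0"
    using lex_less[OF e digit_seq_marks _ j(2) _ inf] by simp
next
  assume less: "tail e 0 < tail (marks S) 0"
  show "marked_below S e"
  proof (rule ccontr)
    assume "\<not> marked_below S e"
    from not_marked_below[OF e S this] less have "\<forall>j\<ge>1. e j = marks S j" by (meson less_asym)
    then have "tail e 0 = tail (marks S) 0" by (simp add: tail_def)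
    with less show False by simp
  qed
qed

text \<open>An eventually maximal \<open>e\<close> cannot have the digits of \<open>marks S\<close>.
  Equal values therefore occur only when \<open>e\<close> precedes lexicographically, which is why
  the endpoint belongs to the interval here.\<close>

lemma marked_below_le_iff:
  assumes e: "digit_seq e" and S: "S \<subseteq> {1..n}" and fin: "finite {j. e j \<noteq> q j - 1}"
  shows "marked_below S e \<longleftrightarrow> tail e 0 \<le> tail (marks S) 0"
proof
  assume "marked_below S e"
  then obtain j where j: "j \<in> S" "\<And>l. l \<in> {1..<j} \<Longrightarrow> e l = marks S l" "e j = 0"
    unfolding marked_below_def by blast
  with S have "j \<ge> 1" "e j < marks S j" by (auto simp: marks_def)
  then show "tail e 0 \<le> tail (marks S) 0"
    using lex_le[OF e digit_seq_marks _ j(2)] by simp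
next
  assume le: "tail e 0 \<le> tail (marks S) 0"
  show "marked_below S e"
  proof (rule ccontr)
    assume "\<not> marked_below S e"
    from not_marked_below[OF e S this] le have eq: "\<forall>j\<ge>1. e j = marks S j" by (meson leD)
    have "{j. marks S j \<noteq> q j - 1} \<subseteq> insert 0 {j. e j \<noteq> q j - 1}"
      using eq by (auto simp: Suc_le_eq)
    with fin infinite_marks_not_max[OF S] show False
      by (meson finite_insert finite_subset)
  qed
qed

end

text \<open>At its last position an elementary interval requires the digit scrambled to 0, while the
  corner has the digit scrambled to 1 there. The difference of these two unscrambled digits fixes
  the time offset between them.\<close>

definition digit_shift :: "(nat \<Rightarrow> nat) \<Rightarrow> (nat \<Rightarrow> nat \<Rightarrow> nat) \<Rightarrow> nat \<Rightarrow> int" where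
  "digit_shift q \<sigma> j =
     int (inv_into {0..q j - 1} (\<sigma> j) 0) - int (inv_into {0..q j - 1} (\<sigma> j) 1)"

section \<open>Scrambled digits along an orbit of the odometer\<close>

locale scrambled_base = cantor_base +
  fixes \<sigma> :: "nat \<Rightarrow> nat \<Rightarrow> nat"
  assumes perm: "j \<ge> 1 \<Longrightarrow> bij_betw (\<sigma> j) {0..q j - 1} {0..q j - 1}"
begin

abbreviation unscramble :: "nat \<Rightarrow> nat \<Rightarrow> nat" where
  "unscramble j \<equiv> inv_into {0..q j - 1} (\<sigma> j)"

lemma unscramble_less:
  assumes "j \<ge> 1" "c < q j"
  shows "unscramble j c < q j"
proof -
  have "unscramble j c \<in> {0..q j - 1}"
    using bij_betw_imp_surj_on[OF perm[OF assms(1)]] assms(2) by (intro inv_into_into) auto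
  then show ?thesis using assms(2) by auto
qed

lemma scramble_less: "j \<ge> 1 \<Longrightarrow> c < q j \<Longrightarrow> \<sigma> j c < q j"
  using bij_betwE[OF perm, of j] by (metis One_nat_def Suc_pred atLeastAtMost_iff less_Suc_eq_le less_nat_zero_code not_gr_zero zero_le)

lemma scramble_eq_iff:
  assumes "j \<ge> 1" "c < q j" "a < q j"
  shows "\<sigma> j a = c \<longleftrightarrow> a = unscramble j c"
  using bij_betw_inv_into_left[OF perm[OF assms(1)], of a] bij_betw_inv_into_right[OF perm[OF assms(1)], of c] assms
  by auto

text \<open>The two preimages are distinct and both lie below \<open>q j\<close>, so their
  difference is nonzero and smaller than \<open>q j\<close> in absolute value.\<close>

lemma digit_shift_mod:
  assumes "j \<ge> 1"
  shows "\<not> int (q j) dvd digit_shift q \<sigma> j"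
proof
  assume dvd: "int (q j) dvd digit_shift q \<sigma> j"
  have q: "1 < q j" "0 < q j" using base_ge_2[OF assms] by auto
  have "\<bar>digit_shift q \<sigma> j\<bar> < int (q j)"
    using unscramble_less[OF assms q(1)] unscramble_less[OF assms q(2)] unfolding digit_shift_def by linarith
  with dvd have "digit_shift q \<sigma> j = 0"
    by (metis dvd_imp_le_int not_le abs_of_nat)
  then have "unscramble j 0 = unscramble j 1" by (simp add: digit_shift_def)
  then show False
    using scramble_eq_iff[OF assms q(2), of "unscramble j 0"] scramble_eq_iff[OF assms q(1), of "unscramble j 0"]
      unscramble_less[OF assms q(2)] by simp
qed

lemma digit_seq_scramble: "digit_seq d \<Longrightarrow> digit_seq (\<lambda>j. \<sigma> j (d j))"
  using scramble_less by (simp add: digit_seq_def)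

lemma digit_scramble_eq_tail: "digit_scramble q \<sigma> x = tail (\<lambda>j. \<sigma> j (cantor_digits q x j)) 0"
  by (simp add: digit_scramble_def tail_def)

lemma digit_scramble_nonneg: "x \<in> {0..<1} \<Longrightarrow> digit_scramble q \<sigma> x \<ge> 0"
  unfolding digit_scramble_eq_tail
  using cantor_digits_expansion unfolding expansion_iff by (intro tail_nonneg digit_seq_scramble) auto

text \<open>The points of an orbit have eventually equal digits, so that the scrambled expansions
  are eventually maximal either for all of them or for none: this decides, uniformly in \<open>n\<close>,
  whether the endpoint must be included.\<close>

lemma orbit_marked_below_iff:
  assumes x: "x \<in> {0..<1}" and S: "S \<subseteq> {1..n}"
  obtains w where "\<And>n. marked_below S (\<lambda>j. \<sigma> j (cantor_digits q ((odometer q ^^ n) x) j)) \<longleftrightarrow>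
      (if w then digit_scramble q \<sigma> ((odometer q ^^ n) x) \<le> (\<Sum>j\<in>S. 1 / real (cantor_prod q j))
       else digit_scramble q \<sigma> ((odometer q ^^ n) x) < (\<Sum>j\<in>S. 1 / real (cantor_prod q j)))"
proof -
  define e where "e n j = \<sigma> j (cantor_digits q ((odometer q ^^ n) x) j)" for n j
  define w where "w = finite {j. e 0 j \<noteq> q j - 1}"
  have e: "digit_seq (e n)" for n
    using cantor_digits_expansion[OF odometer_iterate(1)[OF x, of n]] digit_seq_scramble
    unfolding expansion_iff e_def by blast
  have w: "finite {j. e n j \<noteq> q j - 1} \<longleftrightarrow> w" for n
  proof -
    obtain K where "\<forall>j\<ge>K. cantor_digits q ((odometer q ^^ n) x) j = cantor_digits q x j"
      using odometer_iterate(3)[OF x, of n] unfolding eventually_sequentially by blast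
    then have "e n j = e 0 j" if "j \<ge> K" for j
      using that by (simp add: e_def)
    then have "{j. e n j \<noteq> q j - 1} \<subseteq> {..<K} \<union> {j. e 0 j \<noteq> q j - 1}"
      "{j. e 0 j \<noteq> q j - 1} \<subseteq> {..<K} \<union> {j. e n j \<noteq> q j - 1}"
      by (auto simp: not_less[symmetric])
    then show ?thesis unfolding w_def by (meson finite_Un finite_lessThan finite_subset)
  qed
  have "marked_below S (e n) \<longleftrightarrow>
      (if w then tail (e n) 0 \<le> tail (marks S) 0 else tail (e n) 0 < tail (marks S) 0)" for n
    using marked_below_le_iff[OF e S, of n] marked_below_less_iff[OF e S, of n] w[of n] by auto
  then show ?thesis
    using that[of w] unfolding e_def tail_marks[OF S] digit_scramble_eq_tail by blast
qed

text \<open>Membership in the elementary interval at \<open>j\<close> prescribes the first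
  \<open>j\<close> unscrambled digits, hence the residue of \<open>num d j\<close>. The intervals
  for different \<open>j\<close> are disjoint, so their indicators add up to the indicator of the
  union.\<close>

lemma marked_below_indicator:
  assumes d: "digit_seq d" and S: "S \<subseteq> {1..n}"
  shows "of_bool (marked_below S (\<lambda>j. \<sigma> j (d j))) =
    (\<Sum>j\<in>S. of_bool ([int (num d j) = int (num (\<lambda>l. unscramble l (marks S l)) j) +
       digit_shift q \<sigma> j * int (P (j - 1))] (mod int (P j))) :: real)"
proof -
  define Y where "Y = (\<lambda>l. unscramble l (marks S l))"
  define R where "R j \<longleftrightarrow> (\<forall>l\<in>{1..<j}. d l = Y l) \<and> d j = unscramble j 0" for j
  have Y: "digit_seq Y"
    using unscramble_less digit_seq_marks unfolding Y_def digit_seq_def by blast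
  have fin: "finite S" using S finite_subset by blast
  have R_iff: "R j \<longleftrightarrow> (\<forall>l\<in>{1..<j}. \<sigma> l (d l) = marks S l) \<and> \<sigma> j (d j) = 0" if "j \<in> S" for j
  proof -
    have j: "j \<ge> 1" "0 < q j" "d j < q j" using that S base_ge_2[of j] d by (auto simp: digit_seq_def)
    have "d l = Y l \<longleftrightarrow> \<sigma> l (d l) = marks S l" if "l \<in> {1..<j}" for l
      using scramble_eq_iff[of l "marks S l" "d l"] that d digit_seq_marks[of S] unfolding Y_def digit_seq_def by simp
    then show ?thesis
      unfolding R_def using scramble_eq_iff[OF j] by auto
  qed
  have R_cong: "R j \<longleftrightarrow> [int (num d j) = int (num Y j) + digit_shift q \<sigma> j * int (P (j - 1))] (mod int (P j))"
    if "j \<in> S" for j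
  proof -
    have "j \<ge> 1" using that S by auto
    then obtain i where i: "j = Suc i" by (cases j) auto
    \<comment> \<open>The prescribed digits: those of the corner before \<open>j\<close>, and the
      digit scrambled to 0 at \<open>j\<close>. Only the summand with weight
      \<open>P (j - 1)\<close> differs from \<open>num Y j\<close>.\<close>
    define f where "f = Y(j := unscramble j 0)"
    have f: "digit_seq f"
      using Y unscramble_less[of j 0] base_ge_2[of j] i unfolding f_def digit_seq_def by auto
    have "num f i = num Y i"
      unfolding num_eq_iff[OF f Y] by (auto simp: f_def i)
    then have "int (num f j) = int (num Y j) + digit_shift q \<sigma> j * int (P (j - 1))"
      using that by (simp add: i num_Suc digit_shift_def f_def Y_def marks_def algebra_simps)
    then have "[int (num d j) = int (num Y j) + digit_shift q \<sigma> j * int (P (j - 1))] (mod int (P j))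
        \<longleftrightarrow> [num d j = num f j] (mod P j)"
      by (metis cong_int_iff)
    also have "\<dots> \<longleftrightarrow> R j"
      unfolding num_cong_iff[OF d f] R_def by (auto simp: f_def i le_Suc_eq)
    finally show ?thesis by simp
  qed
  have R_unique: "j = j'" if "j \<in> S" "j' \<in> S" "R j" "R j'" for j j'
  proof -
    \<comment> \<open>Of two intervals, the one with the later position demands the corner digit
      where the earlier one demands a different digit; this gives disjointness.\<close>
    have neq: "unscramble i 0 \<noteq> Y i" if "i \<in> S" for i
      using digit_shift_mod[of i] that S by (auto simp: digit_shift_def Y_def marks_def)
    have "\<not> a < b" if "a \<in> S" "R a" "R b" for a b
      using that S neq[of a] unfolding R_def by fastforce
    then show ?thesis using that by (meson linorder_neqE_nat)
  qed
  have "(\<Sum>j\<in>S. of_bool (R j) :: real) = of_bool (\<exists>j\<in>S. R j)"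
  proof (cases "\<exists>j\<in>S. R j")
    case True
    then obtain j where j: "j \<in> S" "R j" by blast
    have "(\<Sum>i\<in>S. of_bool (R i) :: real) = (\<Sum>i\<in>S. if i = j then 1 else 0)"
      using j R_unique by (intro sum.cong) auto
    then show ?thesis using j fin by auto
  qed auto
  moreover have "(\<exists>j\<in>S. R j) \<longleftrightarrow> marked_below S (\<lambda>j. \<sigma> j (d j))"
    unfolding marked_below_def using R_iff by blast
  ultimately show ?thesis
    using R_cong unfolding Y_def[symmetric] by simp
qed

text \<open>\<open>Z\<close> is a time at which the first \<open>n\<close> digits of the orbit are
  those of the corner. Counted from any \<open>M\<close> congruent to it, \<open>num Y j\<close>
  cancels and only the shift remains. \<open>w\<close> does not depend on \<open>M\<close> or
  \<open>t\<close>, and leaving \<open>M\<close> free in its residue class allows the coordinates to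
  be synchronized later.\<close>

lemma orbit_hits:
  assumes x: "x \<in> {0..<1}" and S: "S \<subseteq> {1..n}"
  shows "\<exists>w Z. \<forall>M t. [M = Z] (mod P n) \<longrightarrow>
      of_bool (if w then digit_scramble q \<sigma> ((odometer q ^^ (M + t)) x) \<le> (\<Sum>j\<in>S. 1 / real (P j))
       else digit_scramble q \<sigma> ((odometer q ^^ (M + t)) x) < (\<Sum>j\<in>S. 1 / real (P j))) =
      (\<Sum>j\<in>S. of_bool ([int t = digit_shift q \<sigma> j * int (P (j - 1))] (mod int (P j))) :: real)"
proof -
  obtain w where w: "\<And>n. marked_below S (\<lambda>j. \<sigma> j (cantor_digits q ((odometer q ^^ n) x) j)) \<longleftrightarrow>
      (if w then digit_scramble q \<sigma> ((odometer q ^^ n) x) \<le> (\<Sum>j\<in>S. 1 / real (P j))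
       else digit_scramble q \<sigma> ((odometer q ^^ n) x) < (\<Sum>j\<in>S. 1 / real (P j)))"
    using orbit_marked_below_iff[OF x S] by metis
  define Y where "Y = (\<lambda>l. unscramble l (marks S l))"
  define d where "d m = cantor_digits q ((odometer q ^^ m) x)" for m
  have d: "digit_seq (d m)" for m
    using cantor_digits_expansion[OF odometer_iterate(1)[OF x, of m]] unfolding expansion_iff d_def by blast
  \<comment> \<open>Adding \<open>P n\<close> before subtracting keeps the difference a natural
    number without changing its residue.\<close>
  define Z where "Z = num Y n + (P n - num (d 0) n)"
  have main: "of_bool (marked_below S (\<lambda>j. \<sigma> j (d (M + t) j))) =
      (\<Sum>j\<in>S. of_bool ([int t = digit_shift q \<sigma> j * int (P (j - 1))] (mod int (P j))) :: real)"
    if M: "[M = Z] (mod P n)" for M t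
  proof -
    have MZ: "[num (d 0) n + M = num Y n] (mod P n)"
    proof -
      have "[num (d 0) n + M = num (d 0) n + Z] (mod P n)"
        using M by (intro cong_add cong_refl)
      moreover have "num (d 0) n + Z = num Y n + P n"
        using num_less[OF d, of 0 n] by (simp add: Z_def)
      ultimately show ?thesis by (simp add: cong_def)
    qed
    have num_d: "[int (num (d (M + t)) j) = int (num Y j) + int t] (mod int (P j))" if "j \<in> S" for j
    proof -
      have j: "j \<le> n" using that S by auto
      have "[num (d 0) n + M = num Y n] (mod P j)"
        using MZ P_dvd[OF j] cong_dvd_modulus_nat by blast
      moreover have "[num (d 0) n + M = num (d 0) j + M] (mod P j)"
        using num_cong_le[OF j] by (intro cong_add cong_refl)
      ultimately have *: "[num (d 0) j + M = num Y j] (mod P j)"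
        using num_cong_le[OF j, of Y] by (simp add: cong_def)
      have "[num (d (M + t)) j = num (d 0) j + (M + t)] (mod P j)"
        using odometer_iterate(2)[OF x, of "M + t" j] by (simp add: d_def)
      also have "[num (d 0) j + (M + t) = num Y j + t] (mod P j)"
        using cong_add[OF * cong_refl[of t]] by (simp add: add.assoc)
      finally show ?thesis by (metis cong_int_iff of_nat_add)
    qed
    have "[int (num (d (M + t)) j) = int (num Y j) + a] (mod int (P j)) \<longleftrightarrow> [int t = a] (mod int (P j))"
      if "j \<in> S" for j a
      using num_d[OF that] cong_add_lcancel[of "int (num Y j)" "int t" a "int (P j)"]
      by (simp add: cong_def)
    then show ?thesis
      unfolding marked_below_indicator[OF d S] Y_def[symmetric] by simp
  qed
  show ?thesis
  proof (intro exI[of _ w] exI[of _ Z] allI impI)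
    fix M t assume "[M = Z] (mod P n)"
    from main[OF this, of t]
    show "of_bool (if w then digit_scramble q \<sigma> ((odometer q ^^ (M + t)) x) \<le> (\<Sum>j\<in>S. 1 / real (P j))
       else digit_scramble q \<sigma> ((odometer q ^^ (M + t)) x) < (\<Sum>j\<in>S. 1 / real (P j))) =
      (\<Sum>j\<in>S. of_bool ([int t = digit_shift q \<sigma> j * int (P (j - 1))] (mod int (P j))) :: real)"
      unfolding w[symmetric] d_def .
  qed
qed

end

section \<open>Star discrepancy and residue classes\<close>

text \<open>The bound by 1 makes the set of values bounded above, so that the real supremum
  dominates each of them.\<close>

lemma star_discrepancy_upper:
  fixes y :: "real ^ 'd::finite"
  assumes "\<And>i. y $ i \<in> {0<..1}" "M \<ge> 1"
  shows "\<bar>local_discrepancy y \<beta> M\<bar> \<le> real M * star_discrepancy \<beta> M"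
proof -
  have "\<bar>local_discrepancy z \<beta> M / real M\<bar> \<le> 1" if z: "\<forall>i. z $ i \<in> {0<..1}" for z :: "real ^ 'd"
  proof -
    have z01: "0 \<le> (\<Prod>i\<in>UNIV. z $ i)" "(\<Prod>i\<in>UNIV. z $ i) \<le> 1"
      using z by (auto intro!: prod_nonneg prod_le_1 simp: less_imp_le)
    have "\<bar>local_discrepancy z \<beta> M\<bar> \<le> (\<Sum>n = 1..M. \<bar>indicator (anchored_box z) (\<beta> n) - (\<Prod>i\<in>UNIV. z $ i)\<bar>)"
      unfolding local_discrepancy_def by (rule sum_abs)
    also have "\<dots> \<le> (\<Sum>n = 1..M. 1)"
      using z01 by (intro sum_mono) (auto simp: indicator_def)
    finally show ?thesis using assms(2) by simp
  qed
  then have "bdd_above ((\<lambda>y. \<bar>local_discrepancy y \<beta> M / real M\<bar>) ` {y. \<forall>i. y $ i \<in> {0<..1}})"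
    by (intro bdd_aboveI2) blast
  then have "\<bar>local_discrepancy y \<beta> M / real M\<bar> \<le> star_discrepancy \<beta> M"
    unfolding star_discrepancy_def using assms(1) by (intro cSUP_upper) auto
  then show ?thesis using assms(2) by (simp add: field_simps)
qed

lemma eventually_less_add_iff_le:
  fixes a b :: real
  shows "\<forall>\<^sub>F \<epsilon> in at_right 0. a < b + \<epsilon> \<longleftrightarrow> a \<le> b"
proof (cases "a \<le> b")
  case True
  then show ?thesis
    by (intro eventually_mono[OF eventually_at_right_less]) auto
next
  case False
  then have "\<forall>\<^sub>F \<epsilon> in at_right 0. \<epsilon> \<in> {0<..<a - b}"
    by (intro eventually_at_right_real) auto
  then show ?thesis
    by eventually_elim (use False in auto)
qed

text \<open>Boxes that are closed in some coordinates are limits of anchored boxes with those sides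
  enlarged by \<open>\<epsilon>\<close>. Only finitely many points matter, so the counts agree for
  all small \<open>\<epsilon>\<close>, while the volumes converge. Sides strictly below 1 leave room
  for the enlargement.\<close>

lemma star_discrepancy_upper_mixed:
  fixes y :: "real ^ 'd::finite" and w :: "'d \<Rightarrow> bool"
  assumes y: "\<And>i. y $ i \<in> {0<..<1}" and "M \<ge> 1" and nonneg: "\<And>n i. \<beta> n $ i \<ge> 0"
  shows "\<bar>\<Sum>n=1..M. of_bool (\<forall>i. if w i then \<beta> n $ i \<le> y $ i else \<beta> n $ i < y $ i) - (\<Prod>i\<in>UNIV. y $ i)\<bar>
    \<le> real M * star_discrepancy \<beta> M"
proof -
  define y' where "y' \<epsilon> = (\<chi> i. if w i then y $ i + \<epsilon> else y $ i)" for \<epsilon>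
  define B where "B n \<longleftrightarrow> (\<forall>i. if w i then \<beta> n $ i \<le> y $ i else \<beta> n $ i < y $ i)" for n
  have "\<forall>\<^sub>F \<epsilon> in at_right 0. \<forall>n\<in>{1..M}. \<forall>i\<in>UNIV.
      (\<beta> n $ i < y' \<epsilon> $ i) \<longleftrightarrow> (if w i then \<beta> n $ i \<le> y $ i else \<beta> n $ i < y $ i)"
    using eventually_less_add_iff_le by (intro eventually_ball_finite ballI) (auto simp: y'_def)
  moreover have "\<forall>\<^sub>F \<epsilon> in at_right 0. \<forall>i\<in>UNIV. y' \<epsilon> $ i \<in> {0<..1}"
  proof (intro eventually_ball_finite ballI)
    fix i
    have "\<forall>\<^sub>F \<epsilon> in at_right 0. \<epsilon> \<in> {0<..<1 - y $ i}"
      using y[of i] by (intro eventually_at_right_real) auto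
    then show "\<forall>\<^sub>F \<epsilon> in at_right 0. y' \<epsilon> $ i \<in> {0<..1}"
      by eventually_elim (use y[of i] in \<open>auto simp: y'_def\<close>)
  qed auto
  ultimately have ev: "\<forall>\<^sub>F \<epsilon> in at_right 0.
      \<bar>\<Sum>n=1..M. of_bool (B n) - (\<Prod>i\<in>UNIV. y' \<epsilon> $ i)\<bar> \<le> real M * star_discrepancy \<beta> M"
  proof eventually_elim
    case (elim \<epsilon>)
    have "indicator (anchored_box (y' \<epsilon>)) (\<beta> n) = (of_bool (B n) :: real)" if "n \<in> {1..M}" for n
      using elim(1) that nonneg[of n] by (auto simp: indicator_def anchored_box_def B_def)
    then have "local_discrepancy (y' \<epsilon>) \<beta> M = (\<Sum>n=1..M. of_bool (B n) - (\<Prod>i\<in>UNIV. y' \<epsilon> $ i))"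
      unfolding local_discrepancy_def by (intro sum.cong) auto
    then show ?case using star_discrepancy_upper[of "y' \<epsilon>" M \<beta>] elim(2) assms(2) by simp
  qed
  have "((\<lambda>\<epsilon>. y' \<epsilon> $ i) \<longlongrightarrow> y $ i) (at_right 0)" for i
    unfolding y'_def by (cases "w i") (auto intro!: tendsto_eq_intros)
  then have "((\<lambda>\<epsilon>. \<Prod>i\<in>UNIV. y' \<epsilon> $ i) \<longlongrightarrow> (\<Prod>i\<in>UNIV. y $ i)) (at_right 0)"
    by (intro tendsto_prod)
  then have "((\<lambda>\<epsilon>. \<bar>\<Sum>n=1..M. of_bool (B n) - (\<Prod>i\<in>UNIV. y' \<epsilon> $ i)\<bar>) \<longlongrightarrow>
      \<bar>\<Sum>n=1..M. of_bool (B n) - (\<Prod>i\<in>UNIV. y $ i)\<bar>) (at_right 0)"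
    by (intro tendsto_rabs tendsto_sum tendsto_diff tendsto_const)
  from tendsto_upperbound[OF this ev] show ?thesis unfolding B_def by simp
qed

lemma residue_class_eq_image:
  fixes A p u :: nat
  assumes "A \<in> {1..p}"
  shows "{t \<in> {1..p * u}. [t = A] (mod p)} = (\<lambda>v. A + p * v) ` {..<u}"
proof (intro equalityI subsetI)
  fix t assume t: "t \<in> {t \<in> {1..p * u}. [t = A] (mod p)}"
  \<comment> \<open>Times start at 1 and \<open>A\<close> may equal \<open>p\<close>, so everything
    is shifted by one before taking remainders.\<close>
  then have "[(t - 1) + 1 = (A - 1) + 1] (mod p)" using assms by simp
  then have "[t - 1 = A - 1] (mod p)" unfolding cong_add_rcancel_nat .
  moreover have "A - 1 < p" using assms by auto
  ultimately have "(t - 1) mod p = A - 1" by (simp add: cong_def)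
  then have "t - 1 = p * ((t - 1) div p) + (A - 1)" by (metis mult_div_mod_eq)
  then have "t = A + p * ((t - 1) div p)" using t assms by auto
  moreover have "(t - 1) div p < u"
    using t by (intro less_mult_imp_div_less) (auto simp: mult.commute)
  ultimately show "t \<in> (\<lambda>v. A + p * v) ` {..<u}" by blast
next
  fix t assume "t \<in> (\<lambda>v. A + p * v) ` {..<u}"
  then obtain v where v: "v < u" "t = A + p * v" by auto
  have "p * (v + 1) \<le> p * u" using v by (intro mult_le_mono2) auto
  then show "t \<in> {t \<in> {1..p * u}. [t = A] (mod p)}"
    using v assms by (auto simp: cong_def)
qed

text \<open>The term \<open>a t\<close> occurs in the partial sums for \<open>M = t, ..., m\<close>,
  that is \<open>m + 1 - t\<close> times.\<close>

lemma sum_partial_sums: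
  fixes a :: "nat \<Rightarrow> real"
  shows "(\<Sum>M=1..m. \<Sum>t=1..M. a t) = (\<Sum>t=1..m. (real m + 1 - real t) * a t)"
proof (induction m)
  case (Suc m)
  have "(\<Sum>t=1..m. (real (Suc m) + 1 - real t) * a t) = (\<Sum>t=1..m. (real m + 1 - real t) * a t) + (\<Sum>t=1..m. a t)"
    by (simp add: sum.distrib[symmetric] algebra_simps)
  then show ?case using Suc by simp
qed simp

text \<open>Both the members \<open>A + p * v\<close> of the class and the constant
  \<open>1 / p\<close> are summed with the weights \<open>m + 1 - t\<close>; each sum is an
  arithmetic series. The representative is taken in \<open>{1..p}\<close> to match times starting at
  1.\<close>

lemma residue_class_average:
  fixes A p m :: nat
  assumes A: "A \<in> {1..p}" and "p dvd m"
  shows "(\<Sum>M=1..m. \<Sum>t=1..M. of_bool ([t = A] (mod p)) - 1 / real p) =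
    real m * (1/2 - real A / real p + 1 / (2 * real p))"
proof -
  obtain u where m: "m = p * u" using assms(2) by auto
  have p: "real p > 0" using A by auto
  have gauss: "(\<Sum>v<u. real v) = real u * (real u - 1) / 2" for u :: nat
    by (induction u) (auto simp: field_simps)
  have gauss': "(\<Sum>t=1..m. real m + 1 - real t) = real m * (real m + 1) / 2"
  proof -
    have *: "(\<Sum>t=1..m. c - real t) = real m * c - real m * (real m + 1) / 2" for c
      by (induction m) (auto simp: field_simps)
    show ?thesis unfolding *[of "real m + 1"] by (simp add: field_simps)
  qed
  have "(\<Sum>t=1..m. (real m + 1 - real t) * of_bool ([t = A] (mod p))) =
      (\<Sum>t\<in>{t\<in>{1..m}. [t = A] (mod p)}. real m + 1 - real t)"
    by (intro sum.mono_neutral_cong_right) auto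
  also have "\<dots> = (\<Sum>v<u. real m + 1 - real (A + p * v))"
    unfolding m residue_class_eq_image[OF A] using p by (subst sum.reindex) (auto simp: inj_on_def)
  also have "\<dots> = real u * (real m + 1 - real A) - real p * (\<Sum>v<u. real v)"
    by (simp add: algebra_simps sum.distrib sum_subtractf sum_distrib_left)
  finally have first: "(\<Sum>t=1..m. (real m + 1 - real t) * of_bool ([t = A] (mod p))) =
      real u * (real m + 1 - real A) - real p * (real u * (real u - 1) / 2)"
    unfolding gauss .
  have second: "(\<Sum>t=1..m. (real m + 1 - real t) * (1 / real p)) = real m * (real m + 1) / 2 / real p"
    unfolding sum_distrib_right[symmetric] gauss' by simp
  have "(\<Sum>M=1..m. \<Sum>t=1..M. of_bool ([t = A] (mod p)) - 1 / real p) =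
      real u * (real m + 1 - real A) - real p * (real u * (real u - 1) / 2) - real m * (real m + 1) / 2 / real p"
    unfolding sum_partial_sums right_diff_distrib[of "_ - _"] sum_subtractf first second ..
  also have "\<dots> = real m * (1/2 - real A / real p + 1 / (2 * real p))"
    using p unfolding m by (simp add: field_simps)
  finally show ?thesis .
qed

lemma cong_prod_iff:
  fixes m :: "'d::finite \<Rightarrow> nat"
  assumes "\<And>i j. i \<noteq> j \<Longrightarrow> coprime (m i) (m j)"
  shows "[a = b] (mod (\<Prod>i\<in>UNIV. m i)) \<longleftrightarrow> (\<forall>i. [a = b] (mod m i))"
proof
  assume "[a = b] (mod (\<Prod>i\<in>UNIV. m i))"
  then show "\<forall>i. [a = b] (mod m i)"
    by (meson cong_dvd_modulus_nat dvd_prodI finite UNIV_I)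
next
  assume "\<forall>i. [a = b] (mod m i)"
  then show "[a = b] (mod (\<Prod>i\<in>UNIV. m i))"
    using assms by (intro coprime_cong_prod_nat) auto
qed

text \<open>The common solution \<open>A\<close> from the Chinese remainder theorem is divisible by
  every \<open>m i\<close>, hence is \<open>r\<close> times their product. Dividing the congruence
  for \<open>i\<close> by \<open>m i\<close> gives the residue condition on \<open>r\<close>, which
  also excludes \<open>r = 0\<close>.\<close>

lemma cofactor_residue:
  fixes m q :: "'d::finite \<Rightarrow> nat" and \<delta> :: "'d \<Rightarrow> int"
  assumes m: "\<And>i. m i > 0" and q: "\<And>i. q i > 0"
    and cop: "\<And>i j. i \<noteq> j \<Longrightarrow> coprime (m i * q i) (m j * q j)"
    and \<delta>: "\<And>i. \<not> int (q i) dvd \<delta> i"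
  shows "\<exists>r. r \<in> {1..<\<Prod>i\<in>UNIV. q i} \<and>
    (\<forall>t. (\<forall>i. [int t = \<delta> i * int (m i)] (mod int (m i * q i))) \<longleftrightarrow>
           [t = r * (\<Prod>i\<in>UNIV. m i)] (mod (\<Prod>i\<in>UNIV. m i * q i))) \<and>
    (\<forall>i. [int (r * (\<Prod>l\<in>UNIV-{i}. m l)) = \<delta> i] (mod int (q i)))"
proof -
  define u where "u i = nat (\<delta> i * int (m i) mod int (m i * q i))" for i
  have pos: "m i * q i > 0" for i using m[of i] q[of i] by simp
  have u: "int (u i) = \<delta> i * int (m i) mod int (m i * q i)" for i
    unfolding u_def using pos[of i] by (subst nat_0_le) auto
  have "\<exists>!A. A < (\<Prod>i\<in>UNIV. m i * q i) \<and> (\<forall>i\<in>UNIV. [A = u i] (mod (m i * q i)))"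
    using pos cop by (intro chinese_remainder_unique_nat) auto
  then obtain A where A: "A < (\<Prod>i\<in>UNIV. m i * q i)" "\<And>i. [A = u i] (mod (m i * q i))"
    by auto
  have A_cong: "[int A = \<delta> i * int (m i)] (mod int (m i * q i))" for i
    using A(2)[of i] unfolding cong_int_iff[symmetric] u by (simp add: cong_def)
  have "m i dvd A" for i
  proof -
    have "[int A = \<delta> i * int (m i)] (mod int (m i))"
      using A_cong[of i] by (rule cong_dvd_modulus) auto
    then have "int (m i) dvd int A" by (simp add: cong_def dvd_eq_mod_eq_0)
    then show ?thesis by simp
  qed
  then have "[A = 0] (mod (\<Prod>i\<in>UNIV. m i))"
    using cop by (subst cong_prod_iff) (auto simp: cong_0_iff)
  then obtain r where r: "A = r * (\<Prod>i\<in>UNIV. m i)"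
    unfolding cong_0_iff by (metis dvd_div_mult_self)
  have m_split: "(\<Prod>i\<in>UNIV. m i) = m i * (\<Prod>l\<in>UNIV-{i}. m l)" for i
    by (simp add: prod.remove)
  have r_cong: "[int (r * (\<Prod>l\<in>UNIV-{i}. m l)) = \<delta> i] (mod int (q i))" for i
  proof -
    have "int (m i) * int (q i) dvd int (m i) * (int (r * (\<Prod>l\<in>UNIV-{i}. m l)) - \<delta> i)"
      using A_cong[of i] unfolding r m_split[of i] cong_iff_dvd_diff
      by (simp add: algebra_simps)
    then show ?thesis
      using m[of i] by (simp add: cong_iff_dvd_diff)
  qed
  have "r \<noteq> 0"
  proof
    assume "r = 0"
    \<comment> \<open>\<open>undefined\<close> stands for an arbitrary coordinate.\<close>
    then have "int (q undefined) dvd \<delta> undefined"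
      using r_cong[of undefined] by (auto simp: cong_iff_dvd_diff)
    with \<delta> show False by blast
  qed
  moreover have "r < (\<Prod>i\<in>UNIV. q i)"
  proof -
    have "r * (\<Prod>i\<in>UNIV. m i) < (\<Prod>i\<in>UNIV. q i) * (\<Prod>i\<in>UNIV. m i)"
      using A(1) by (simp add: r prod.distrib mult.commute)
    then show ?thesis by simp
  qed
  moreover have "(\<forall>i. [int t = \<delta> i * int (m i)] (mod int (m i * q i))) \<longleftrightarrow>
      [t = r * (\<Prod>i\<in>UNIV. m i)] (mod (\<Prod>i\<in>UNIV. m i * q i))" for t
  proof -
    have "[int t = \<delta> i * int (m i)] (mod int (m i * q i)) \<longleftrightarrow> [t = A] (mod (m i * q i))" for i
      using A_cong[of i] unfolding cong_int_iff[symmetric] by (auto simp: cong_def)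
    then show ?thesis using cong_prod_iff[where m = "\<lambda>i. m i * q i" and a = t and b = A, OF cop] r by simp
  qed
  ultimately show ?thesis using r_cong by (intro exI[of _ r]) auto
qed

section \<open>Selecting digit positions\<close>

lemma abs_sum_ge_card:
  fixes f :: "'a \<Rightarrow> real"
  assumes "(\<forall>x\<in>X. c \<le> f x) \<or> (\<forall>x\<in>X. f x \<le> - c)"
  shows "\<bar>\<Sum>x\<in>X. f x\<bar> \<ge> real (card X) * c"
  using assms
proof
  assume "\<forall>x\<in>X. c \<le> f x"
  then have "(\<Sum>x\<in>X. c) \<le> (\<Sum>x\<in>X. f x)" by (intro sum_mono) auto
  then show ?thesis by simp
next
  assume "\<forall>x\<in>X. f x \<le> - c"
  then have "(\<Sum>x\<in>X. f x) \<le> (\<Sum>x\<in>X. - c)" by (intro sum_mono) auto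
  then show ?thesis by simp
qed

lemma pigeonhole_fiber:
  assumes "finite A" "finite B" "f \<in> A \<rightarrow> B" "card B \<le> c"
  shows "\<exists>b. card A \<le> c * card {a \<in> A. f a = b}"
proof (cases "A = {}")
  case False
  then obtain b where "card A \<le> card (f -` {b} \<inter> A) * card B"
    using pigeonhole_card[OF assms(3,1,2)] assms(3) by auto
  also have "f -` {b} \<inter> A = {a \<in> A. f a = b}" by auto
  also have "card {a \<in> A. f a = b} * card B \<le> card {a \<in> A. f a = b} * c"
    using assms(4) by (intro mult_le_mono2)
  finally show ?thesis by (auto simp: mult.commute)
qed simp

section \<open>Choosing positions for which the averages do not cancel\<close>

locale coprime_moduli =
  fixes q :: "'d::finite \<Rightarrow> nat"
  assumes card_ge_2: "CARD('d) \<ge> 2"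
    and modulus_ge_2: "q i \<ge> 2"
    and coprime_moduli: "i \<noteq> j \<Longrightarrow> coprime (q i) (q j)"
begin

abbreviation Q :: nat where
  "Q \<equiv> \<Prod>i\<in>UNIV. q i"

abbreviation cofactor :: "'d \<Rightarrow> nat" where
  "cofactor i \<equiv> \<Prod>l\<in>UNIV-{i}. q l"

lemma Q_eq: "Q = q i * cofactor i"
  by (simp add: prod.remove)

lemma Q_pos: "Q > 0"
proof -
  have "q i > 0" for i using modulus_ge_2[of i] by simp
  then show ?thesis by simp
qed

lemma real_Q_pos: "real Q > 0"
  using Q_pos by (simp only: of_nat_0_less_iff)

lemma coprime_cofactor: "coprime (cofactor i) (q i)"
  by (intro prod_coprime_left coprime_moduli) auto

text \<open>This is where at least two coordinates are needed: some modulus is odd, and it would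
  divide \<open>Q = 2 r\<close>, hence \<open>r\<close>.\<close>

lemma twice_ne_Q:
  assumes "\<And>i. \<not> q i dvd r"
  shows "2 * r \<noteq> Q"
proof
  assume eq: "2 * r = Q"
  obtain i j :: 'd where "i \<noteq> j"
    using card_ge_2 by (metis (full_types) One_nat_def card_1_singleton_iff card_2_iff' ex_card obtain_subset_with_card_n UNIV_I)
  then have "odd (q i) \<or> odd (q j)"
    using coprime_moduli[of i j] coprime_common_divisor by fastforce
  then obtain i where "odd (q i)" by blast
  then have "coprime (q i) 2" by simp
  moreover have "q i dvd 2 * r" unfolding eq by (intro dvd_prodI) auto
  ultimately have "q i dvd r" by (simp add: coprime_dvd_mult_right_iff)
  with assms show False by blast
qed

text \<open>The numerator \<open>Q - 2 * r\<close> is a nonzero integer.\<close>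

lemma half_minus_ge:
  assumes "\<And>i. \<not> q i dvd r"
  shows "\<bar>1/2 - real r / real Q\<bar> \<ge> 1 / (2 * real Q)"
proof -
  have "\<bar>int Q - 2 * int r\<bar> \<ge> 1" using twice_ne_Q[OF assms] by linarith
  then have "\<bar>real Q - 2 * real r\<bar> \<ge> 1" by linarith
  then have "\<bar>real Q - 2 * real r\<bar> / (2 * real Q) \<ge> 1 / (2 * real Q)"
    by (intro divide_right_mono) (auto intro!: prod_nonneg)
  moreover have "1/2 - real r / real Q = (real Q - 2 * real r) / (2 * real Q)"
    using Q_pos by (simp add: field_simps)
  moreover have "\<bar>2 * real Q\<bar> = 2 * real Q" by (rule abs_of_nonneg) (auto intro!: prod_nonneg)
  ultimately show ?thesis by (simp only: abs_divide)
qed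

text \<open>Since \<open>V i\<close> and the cofactors are invertible modulo \<open>q i\<close>, the
  number \<open>r k\<close> depends only on the classes of \<open>\<delta> i (k i)\<close> modulo
  \<open>q i\<close>. Restricting positions to suitable classes therefore controls the sign and the
  size of every summand.\<close>

lemma select_positions:
  fixes J :: "'d \<Rightarrow> nat set" and \<delta> :: "'d \<Rightarrow> nat \<Rightarrow> int" and r :: "('d \<Rightarrow> nat) \<Rightarrow> nat" and V :: "'d \<Rightarrow> nat"
  assumes fin: "\<And>i. finite (J i)" and ne: "\<And>i. J i \<noteq> {}"
    and r_less: "\<And>k. k \<in> PiE UNIV J \<Longrightarrow> r k < Q"
    and cong: "\<And>k i. k \<in> PiE UNIV J \<Longrightarrow> [int (r k * V i) = \<delta> i (k i) * int (cofactor i)] (mod int (q i))"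
    and V: "\<And>i. coprime (V i) (q i)"
    and \<delta>: "\<And>i j. j \<in> J i \<Longrightarrow> \<not> int (q i) dvd \<delta> i j"
  obtains S where "\<And>i. S i \<subseteq> J i" "\<And>i. S i \<noteq> {}"
    "\<bar>\<Sum>k\<in>PiE UNIV S. 1/2 - real (r k) / real Q\<bar> \<ge> (\<Prod>i\<in>UNIV. real (card (J i))) / (2 ^ (CARD('d) + 1) * real Q)"
proof -
  define cl where "cl i j = \<delta> i j mod int (q i)" for i j
  define f where "f k = 1/2 - real (r k) / real Q" for k
  have q_pos: "q i > 0" for i using modulus_ge_2[of i] by simp
  have card_J: "card (J i) > 0" for i using fin ne by (simp add: card_gt_0_iff)
  have r_cong_iff: "[r k = r k'] (mod q i) \<longleftrightarrow> cl i (k i) = cl i (k' i)"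
    if k: "k \<in> PiE UNIV J" "k' \<in> PiE UNIV J" for k k' i
  proof -
    have "[r k = r k'] (mod q i) \<longleftrightarrow> [int (r k * V i) = int (r k' * V i)] (mod int (q i))"
      unfolding cong_int_iff using V by (simp add: cong_mult_rcancel_nat)
    also have "\<dots> \<longleftrightarrow> [\<delta> i (k i) * int (cofactor i) = \<delta> i (k' i) * int (cofactor i)] (mod int (q i))"
      using cong[OF k(1), of i] cong[OF k(2), of i] by (simp add: cong_def)
    also have "\<dots> \<longleftrightarrow> [\<delta> i (k i) = \<delta> i (k' i)] (mod int (q i))"
      using coprime_cofactor[of i] by (intro cong_mult_rcancel) (simp only: coprime_int_iff)
    finally show ?thesis by (simp add: cl_def cong_def)
  qed
  have not_dvd: "\<not> q i dvd r k" if "k \<in> PiE UNIV J" for k i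
  proof
    assume "q i dvd r k"
    then have "[int (r k * V i) = 0] (mod int (q i))"
      by (simp add: cong_0_iff del: of_nat_mult)
    then have "int (q i) dvd \<delta> i (k i) * int (cofactor i)"
      using cong[OF that, of i] by (simp add: cong_def dvd_eq_mod_eq_0)
    moreover have "coprime (int (q i)) (int (cofactor i))"
      unfolding coprime_int_iff using coprime_cofactor[of i] by (simp add: coprime_commute)
    ultimately have "int (q i) dvd \<delta> i (k i)"
      by (simp add: coprime_dvd_mult_left_iff del: of_nat_prod)
    then show False using \<delta>[of "k i" i] that by auto
  qed
  have r_eq: "r k = r k'" if k: "k \<in> PiE UNIV J" "k' \<in> PiE UNIV J" and "\<And>i. cl i (k i) = cl i (k' i)" for k k'
  proof -
    have "[r k = r k'] (mod Q)"
      using that r_cong_iff[OF k] coprime_moduli by (subst cong_prod_iff) auto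
    then show ?thesis using r_less[OF k(1)] r_less[OF k(2)] by (simp add: cong_def)
  qed
  \<comment> \<open>\<open>f\<close> can be as small as \<open>1/(2Q)\<close>, but with all coordinates except \<open>i0\<close> fixed it is smaller than
    \<open>1/(2 q i0)\<close> for at most one class. So either every coordinate has a class containing half of the
    positions, and these classes are taken, or in some coordinate the bad class can be discarded.\<close>
  show ?thesis
  proof (cases "\<forall>i. \<exists>c. card (J i) \<le> 2 * card {j\<in>J i. cl i j = c}")
    case True
    then obtain c where c: "\<And>i. card (J i) \<le> 2 * card {j\<in>J i. cl i j = c i}" by metis
    define S where "S i = {j\<in>J i. cl i j = c i}" for i
    have card_S: "real (card (J i)) / 2 \<le> real (card (S i))" for i
      using c[of i] by (simp add: S_def)
    have "card (S i) > 0" for i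
      using c[of i] card_J[of i] by (simp add: S_def)
    then have S: "S i \<subseteq> J i" "S i \<noteq> {}" for i
      by (auto simp: S_def card_gt_0_iff)
    define k0 where "k0 i = (SOME j. j \<in> S i)" for i
    have k0: "k0 i \<in> S i" for i unfolding k0_def using S(2) by (simp add: some_in_eq)
    have sub: "PiE UNIV S \<subseteq> PiE UNIV J" using S(1) by (intro PiE_mono) auto
    have k0J: "k0 \<in> PiE UNIV J" using k0 sub by (auto simp: PiE_def)
    have rk: "r k = r k0" if "k \<in> PiE UNIV S" for k
    proof (rule r_eq)
      show "k \<in> PiE UNIV J" using that sub by auto
      show "cl i (k i) = cl i (k0 i)" for i
        using PiE_mem[OF that, of i] k0[of i] by (auto simp: S_def)
    qed (rule k0J)
    have "\<bar>f k0\<bar> \<ge> 1 / (2 * real Q)"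
      unfolding f_def using not_dvd[OF k0J] by (rule half_minus_ge)
    then have "(\<forall>k\<in>PiE UNIV S. 1 / (2 * real Q) \<le> f k) \<or> (\<forall>k\<in>PiE UNIV S. f k \<le> - (1 / (2 * real Q)))"
      using rk by (auto simp: f_def abs_le_iff abs_if split: if_splits)
    then have "real (card (PiE UNIV S)) * (1 / (2 * real Q)) \<le> \<bar>\<Sum>k\<in>PiE UNIV S. f k\<bar>"
      by (rule abs_sum_ge_card)
    moreover have "real (card (PiE UNIV S)) \<ge> (\<Prod>i\<in>(UNIV::'d set). real (card (J i)) / 2)"
      unfolding card_PiE[OF finite] of_nat_prod using card_S by (intro prod_mono) auto
    then have "real (card (PiE UNIV S)) * (1 / (2 * real Q)) \<ge> (\<Prod>i\<in>(UNIV::'d set). real (card (J i)) / 2) * (1 / (2 * real Q))"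
      by (intro mult_right_mono) (auto intro!: prod_nonneg)
    moreover have "(\<Prod>i\<in>(UNIV::'d set). real (card (J i)) / 2) * (1 / (2 * real Q)) =
        (\<Prod>i\<in>UNIV. real (card (J i))) / (2 ^ (CARD('d) + 1) * real Q)"
      by (simp add: prod_dividef)
    ultimately show ?thesis using S by (intro that[of S]) (auto simp: f_def)
  next
    case False
    then obtain i0 where i0: "\<And>c. 2 * card {j\<in>J i0. cl i0 j = c} < card (J i0)"
      by (auto simp: not_le)
    have "\<exists>c. card (J i) \<le> q i * card {j\<in>J i. cl i j = c}" for i
      using q_pos[of i] fin by (intro pigeonhole_fiber[where B = "{0..<int (q i)}"]) (auto simp: cl_def)
    then obtain c where c: "\<And>i. card (J i) \<le> q i * card {j\<in>J i. cl i j = c i}" by metis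
    define T where "T i = {j\<in>J i. cl i j = c i}" for i
    have "card (T i) > 0" for i
      using c[of i] card_J[of i] by (intro Nat.gr0I) (simp add: T_def)
    then have T: "T i \<subseteq> J i" "T i \<noteq> {}" for i
      by (auto simp: T_def card_gt_0_iff)
    define k0 where "k0 i = (SOME j. j \<in> T i)" for i
    have k0: "k0 i \<in> T i" for i unfolding k0_def using T(2) by (simp add: some_in_eq)
    define g where "g j = f (k0(i0 := j))" for j
    have k0J: "k0(i0 := j) \<in> PiE UNIV J" if "j \<in> J i0" for j
      using that subsetD[OF T(1) k0] by (auto simp: PiE_def)
    define bad where "bad = {j\<in>J i0. \<bar>g j\<bar> < 1 / (2 * real (q i0))}"
    \<comment> \<open>Two values of \<open>r\<close> that agree in all coordinates but
      \<open>i0\<close> differ by a multiple of \<open>cofactor i0 = Q / q i0\<close>. If both are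
      bad, they differ by less than that, so they are equal and so are their classes at
      \<open>i0\<close>.\<close>
    have bad_cl: "cl i0 j = cl i0 j'" if "j \<in> bad" "j' \<in> bad" for j j'
    proof -
      define a b where "a = r (k0(i0 := j))" and "b = r (k0(i0 := j'))"
      have jJ: "j \<in> J i0" "j' \<in> J i0" using that by (auto simp: bad_def)
      have "[a = b] (mod q i)" if "i \<noteq> i0" for i
        unfolding a_def b_def using that by (subst r_cong_iff[OF k0J[OF jJ(1)] k0J[OF jJ(2)]]) simp
      then have "[a = b] (mod cofactor i0)"
        using coprime_moduli by (intro coprime_cong_prod_nat) auto
      then have "int (cofactor i0) dvd int a - int b"
        by (simp add: cong_iff_dvd_diff flip: cong_int_iff)
      moreover have "\<bar>int a - int b\<bar> < int (cofactor i0)"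
      proof -
        have "\<bar>real a / real Q - real b / real Q\<bar> < 1 / real (q i0)"
        proof -
          have "\<bar>1/2 - real a / real Q\<bar> < 1 / (2 * real (q i0))" "\<bar>1/2 - real b / real Q\<bar> < 1 / (2 * real (q i0))"
            using that by (auto simp: bad_def g_def f_def a_def b_def)
          moreover have "1 / real (q i0) = 1 / (2 * real (q i0)) + 1 / (2 * real (q i0))"
            by simp
          ultimately show ?thesis by linarith
        qed
        then have "\<bar>real a / real Q - real b / real Q\<bar> * real Q < 1 / real (q i0) * real Q"
          by (rule mult_strict_right_mono[OF _ real_Q_pos])
        moreover have "\<bar>real a / real Q - real b / real Q\<bar> * real Q = \<bar>real a - real b\<bar>"
        proof -
          have "\<bar>real a / c - real b / c\<bar> * c = \<bar>real a - real b\<bar>" if "c > 0" for c :: real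
            using that by (simp add: diff_divide_distrib[symmetric] abs_divide)
          from this[OF real_Q_pos] show ?thesis .
        qed
        moreover have "1 / real (q i0) * real Q = real (cofactor i0)"
          unfolding Q_eq[of i0] using q_pos[of i0] by simp
        ultimately have "\<bar>real a - real b\<bar> < real (cofactor i0)" by simp
        then show ?thesis by linarith
      qed
      ultimately have "int a - int b = 0"
        by (metis dvd_imp_le_int not_le abs_of_nat)
      then have "a = b" by simp
      then show ?thesis
        using r_cong_iff[OF k0J[OF jJ(1)] k0J[OF jJ(2)], of i0] by (simp add: a_def b_def)
    qed
    have card_bad: "2 * card bad < card (J i0)"
    proof (cases "bad = {}")
      case True then show ?thesis using card_J by simp
    next
      case False
      then obtain j where j: "j \<in> bad" by blast
      have "bad \<subseteq> {j'\<in>J i0. cl i0 j' = cl i0 j}"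
      proof
        fix j' assume j': "j' \<in> bad"
        then have "j' \<in> J i0" by (simp add: bad_def)
        then show "j' \<in> {j'\<in>J i0. cl i0 j' = cl i0 j}" using bad_cl[OF j' j] by simp
      qed
      then have "card bad \<le> card {j'\<in>J i0. cl i0 j' = cl i0 j}"
        using fin by (intro card_mono) auto
      then show ?thesis using i0[of "cl i0 j"] by simp
    qed
    define pos neg where "pos = {j\<in>J i0 - bad. g j > 0}" and "neg = {j\<in>J i0 - bad. g j \<le> 0}"
    have "card pos + card neg + card bad = card (J i0)"
    proof -
      have "card (pos \<union> neg \<union> bad) = card (pos \<union> neg) + card bad"
        using fin by (intro card_Un_disjoint) (auto simp: pos_def neg_def bad_def)
      also have "card (pos \<union> neg) = card pos + card neg"
        using fin by (intro card_Un_disjoint) (auto simp: pos_def neg_def)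
      also have "pos \<union> neg \<union> bad = J i0"
        by (auto simp: pos_def neg_def bad_def)
      finally show ?thesis by simp
    qed
    \<comment> \<open>More than half of the positions are not bad, so one of the two signs gets more
      than a quarter.\<close>
    with card_bad have "card (J i0) < 4 * card pos \<or> card (J i0) < 4 * card neg" by linarith
    then obtain S0 where S0: "S0 = pos \<or> S0 = neg" "card (J i0) < 4 * card S0" by blast
    define S where "S i = (if i = i0 then S0 else T i)" for i
    have "S0 \<noteq> {}" using S0(2) by auto
    moreover have "S0 \<subseteq> J i0" using S0(1) by (auto simp: pos_def neg_def)
    ultimately have S: "S i \<subseteq> J i" "S i \<noteq> {}" for i
      using T[of i] by (simp_all add: S_def)
    have fk: "f k = g (k i0) \<and> k i0 \<in> S0" if "k \<in> PiE UNIV S" for k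
    proof -
      have kS: "k i \<in> S i" for i using PiE_mem[OF that, of i] by simp
      have "r k = r (k0(i0 := k i0))"
      proof (rule r_eq)
        show "k \<in> PiE UNIV J" using subsetD[OF S(1) kS] by (auto simp: PiE_def)
        show "k0(i0 := k i0) \<in> PiE UNIV J" using subsetD[OF S(1) kS] by (intro k0J)
        show "cl i (k i) = cl i ((k0(i0 := k i0)) i)" for i
          using kS[of i] k0[of i] by (auto simp: S_def T_def)
      qed
      then show ?thesis using kS[of i0] by (simp add: f_def g_def S_def)
    qed
    have "(\<forall>k\<in>PiE UNIV S. 1 / (2 * real (q i0)) \<le> f k) \<or> (\<forall>k\<in>PiE UNIV S. f k \<le> - (1 / (2 * real (q i0))))"
    proof (cases "S0 = pos")
      case True
      have "1 / (2 * real (q i0)) \<le> f k" if "k \<in> PiE UNIV S" for k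
        using fk[OF that] True by (auto simp: pos_def bad_def)
      then show ?thesis by blast
    next
      case False
      then have "S0 = neg" using S0 by blast
      then have "f k \<le> - (1 / (2 * real (q i0)))" if "k \<in> PiE UNIV S" for k
        using fk[OF that] by (auto simp: neg_def bad_def)
      then show ?thesis by blast
    qed
    then have 1: "real (card (PiE UNIV S)) * (1 / (2 * real (q i0))) \<le> \<bar>\<Sum>k\<in>PiE UNIV S. f k\<bar>"
      by (rule abs_sum_ge_card)
    \<comment> \<open>Corrects the generic loss of a factor \<open>q i\<close> to the loss of a
      factor 4 at \<open>i0\<close>, so that one product formula covers all coordinates.\<close>
    define h where "h i = (if i = i0 then real (q i0) / 4 else 1)" for i
    have card_S: "real (card (J i)) / real (q i) * h i \<le> real (card (S i))" for i
    proof (cases "i = i0")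
      case True
      then show ?thesis using S0(2) q_pos[of i0] by (simp add: S_def h_def)
    next
      case False
      have "real (card (J i)) \<le> real (q i * card (T i))"
        using c[of i] unfolding T_def of_nat_le_iff .
      then show ?thesis using False q_pos[of i] by (simp add: S_def h_def field_simps)
    qed
    have h_prod: "(\<Prod>i\<in>UNIV. h i) = real (q i0) / 4"
      by (simp add: h_def prod.delta)
    have "(\<Prod>i\<in>(UNIV::'d set). real (card (J i)) / real (q i) * h i) \<le> real (card (PiE UNIV S))"
      unfolding card_PiE[OF finite] of_nat_prod using card_S
      by (intro prod_mono) (auto simp: h_def)
    then have "(\<Prod>i\<in>(UNIV::'d set). real (card (J i)) / real (q i) * h i) * (1 / (2 * real (q i0))) \<le>
        real (card (PiE UNIV S)) * (1 / (2 * real (q i0)))"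
      by (intro mult_right_mono) auto
    moreover have "(\<Prod>i\<in>(UNIV::'d set). real (card (J i)) / real (q i) * h i) * (1 / (2 * real (q i0))) =
        (\<Prod>i\<in>UNIV. real (card (J i))) / (8 * real Q)"
      using q_pos[of i0] by (simp add: prod.distrib prod_dividef h_prod)
    \<comment> \<open>The 8 is the loss 4 at \<open>i0\<close> times the 2 in
      \<open>1 / (2 * q i0)\<close>; it is at most \<open>2 ^ (CARD('d) + 1)\<close> as there are at
      least two coordinates.\<close>
    moreover have "(\<Prod>i\<in>UNIV. real (card (J i))) / (2 ^ (CARD('d) + 1) * real Q) \<le> (\<Prod>i\<in>UNIV. real (card (J i))) / (8 * real Q)"
    proof (intro divide_left_mono mult_right_mono)
      have "(2::real) ^ 3 \<le> 2 ^ (CARD('d) + 1)"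
        using card_ge_2 by (intro power_increasing) auto
      then show "(8::real) \<le> 2 ^ (CARD('d) + 1)" by simp
    qed (use q_pos in \<open>auto intro!: prod_nonneg prod_pos mult_pos_pos\<close>)
    ultimately show ?thesis using S 1 by (intro that[of S]) (auto simp: f_def)
  qed
qed

end

section \<open>The lower bound\<close>

lemma odometer_vec_iterate: "(odometer_vec p ^^ n) x $ i = (odometer (p i) ^^ n) (x $ i)"
  by (induction n) (auto simp: odometer_vec_def)

lemma halton_nth: "halton p \<sigma> n x $ i = digit_scramble (p i) (\<sigma> i) ((odometer (p i) ^^ n) (x $ i))"
  by (simp add: halton_def digit_scramble_vec_def odometer_vec_iterate)

lemma of_bool_all_eq_prod: "of_bool (\<forall>i. R i) = (\<Prod>i\<in>(UNIV::'d::finite set). of_bool (R i) :: real)"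
  by (cases "\<forall>i. R i") auto

locale halton_bases =
  fixes p :: "'d::finite \<Rightarrow> nat \<Rightarrow> nat" and \<sigma> :: "'d \<Rightarrow> nat \<Rightarrow> nat \<Rightarrow> nat"
  assumes scrambled: "scrambled_base (p i) (\<sigma> i)"
    and coprime_bases: "i \<noteq> j \<Longrightarrow> a \<ge> 1 \<Longrightarrow> b \<ge> 1 \<Longrightarrow> coprime (p i a) (p j b)"
begin

abbreviation P :: "'d \<Rightarrow> nat \<Rightarrow> nat" where
  "P i \<equiv> cantor_prod (p i)"

abbreviation shift :: "'d \<Rightarrow> nat \<Rightarrow> int" where
  "shift i \<equiv> digit_shift (p i) (\<sigma> i)"

lemma base: "cantor_base (p i)"
  using scrambled[of i] by (simp add: scrambled_base_def)

lemmas base_facts = cantor_base.P_pos[OF base] cantor_base.P_dvd[OF base]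

lemma coprime_P: "i \<noteq> j \<Longrightarrow> coprime (P i a) (P j b)"
  unfolding cantor_prod_def by (intro prod_coprime_left prod_coprime_right coprime_bases) auto

definition peak :: "real ^ 'd \<Rightarrow> nat \<Rightarrow> real" where
  "peak x N = Max ((\<lambda>M. real M * star_discrepancy (\<lambda>n. halton p \<sigma> n x) M) ` {1..N})"

text \<open>The left side is the mean over one full period of the discrepancy counted from
  \<open>M0\<close>. Each such value is a difference of two discrepancies from time 0, each bounded
  by \<open>peak x N\<close>; hence the factor 2.\<close>

lemma average_le_peak:
  assumes x: "x \<in> unit_cube" and S: "\<And>i. S i \<subseteq> {1..n}" "\<And>i. S i \<noteq> {}"
    and N: "2 * (\<Prod>i\<in>UNIV. P i n) \<le> N"
    and A: "\<And>k. k \<in> PiE UNIV S \<Longrightarrow> A k \<in> {1..\<Prod>i\<in>UNIV. P i (k i)}"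
    and A_iff: "\<And>k t. k \<in> PiE UNIV S \<Longrightarrow>
      (\<forall>i. [int t = shift i (k i) * int (P i (k i - 1))] (mod int (P i (k i)))) \<longleftrightarrow>
      [t = A k] (mod (\<Prod>i\<in>UNIV. P i (k i)))"
  shows "\<bar>\<Sum>k\<in>PiE UNIV S. 1/2 - real (A k) / real (\<Prod>i\<in>UNIV. P i (k i)) + 1 / (2 * real (\<Prod>i\<in>UNIV. P i (k i)))\<bar>
    \<le> 2 * peak x N"
proof -
  define y where "y = (\<chi> i. \<Sum>j\<in>S i. 1 / real (P i j))"
  define \<beta> where "\<beta> n = halton p \<sigma> n x" for n
  define m where "m = (\<Prod>i\<in>UNIV. P i n)"
  have m_pos: "m > 0" using base_facts(1) by (simp add: m_def)
  have xi: "x $ i \<in> {0..<1}" for i using x by (auto simp: unit_cube_def)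
  have finS: "finite (S i)" for i using S(1) finite_subset by blast
  have y: "y $ i \<in> {0<..<1}" for i
    using cantor_base.tail_marks_less_1[OF base S(1)] cantor_base.tail_marks_pos[OF base S(1) S(2)]
    by (simp add: y_def)
  define R where "R i w Z \<longleftrightarrow> (\<forall>M t. [M = Z] (mod P i n) \<longrightarrow>
      of_bool (if w then \<beta> (M + t) $ i \<le> y $ i else \<beta> (M + t) $ i < y $ i) =
      (\<Sum>j\<in>S i. of_bool ([int t = shift i j * int (P i (j - 1))] (mod int (P i j))) :: real))" for i w Z
  have "\<exists>w Z. R i w Z" for i
    unfolding R_def \<beta>_def halton_nth y_def vec_lambda_beta
    by (rule scrambled_base.orbit_hits[OF scrambled xi S(1)])
  then obtain w Z where R: "\<And>i. R i (w i) (Z i)" by metis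
  have wZ: "of_bool (if w i then \<beta> (M + t) $ i \<le> y $ i else \<beta> (M + t) $ i < y $ i) =
      (\<Sum>j\<in>S i. of_bool ([int t = shift i j * int (P i (j - 1))] (mod int (P i j))) :: real)"
    if "[M = Z i] (mod P i n)" for i M t
    using R[of i] that unfolding R_def by blast
  \<comment> \<open>The periods of the coordinates are coprime, so a single starting time serves all
    of them.\<close>
  have "\<exists>!M. M < m \<and> (\<forall>i\<in>UNIV. [M = Z i] (mod P i n))"
    unfolding m_def using base_facts(1) coprime_P by (intro chinese_remainder_unique_nat) auto
  then obtain M0 where M0: "M0 < m" "\<And>i. [M0 = Z i] (mod P i n)" by auto
  define B where "B n \<longleftrightarrow> (\<forall>i. if w i then \<beta> n $ i \<le> y $ i else \<beta> n $ i < y $ i)" for n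
  define G where "G M = (\<Sum>n=1..M. of_bool (B n) - (\<Prod>i\<in>UNIV. y $ i))" for M
  have nonneg: "\<beta> n $ i \<ge> 0" for n i
    unfolding \<beta>_def halton_nth
    by (intro scrambled_base.digit_scramble_nonneg[OF scrambled] cantor_base.odometer_iterate(1)[OF base xi])
  have G_le1: "\<bar>G M\<bar> \<le> peak x N" if "M \<in> {1..N}" for M
  proof -
    have "\<bar>G M\<bar> \<le> real M * star_discrepancy \<beta> M"
      unfolding G_def B_def using that by (intro star_discrepancy_upper_mixed y nonneg) auto
    also have "\<dots> \<le> peak x N"
      unfolding peak_def \<beta>_def using that by (intro Max_ge) auto
    finally show ?thesis .
  qed
  \<comment> \<open>\<open>M0\<close> may be 0, where the sum is empty and only the nonnegativity of
    \<open>peak x N\<close> is needed.\<close>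
  have G_le: "\<bar>G M\<bar> \<le> peak x N" if "M \<le> N" for M
  proof (cases "M = 0")
    case True
    have "1 \<in> {1..N}" using N m_pos unfolding m_def[symmetric] by auto
    from G_le1[OF this] have "peak x N \<ge> 0" by linarith
    then show ?thesis by (simp add: True G_def)
  qed (use that G_le1[of M] in auto)
  have B_eq: "of_bool (B (M0 + t)) - (\<Prod>i\<in>UNIV. y $ i) =
      (\<Sum>k\<in>PiE UNIV S. of_bool ([t = A k] (mod (\<Prod>i\<in>UNIV. P i (k i)))) - 1 / real (\<Prod>i\<in>UNIV. P i (k i)))" for t
  proof -
    have "of_bool (B (M0 + t)) =
        (\<Prod>i\<in>UNIV. \<Sum>j\<in>S i. of_bool ([int t = shift i j * int (P i (j - 1))] (mod int (P i j))) :: real)"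
      unfolding B_def of_bool_all_eq_prod using wZ[OF M0(2)] by simp
    \<comment> \<open>Expanding the product of coordinate sums yields one term for each choice
      \<open>k\<close> of positions; its joint congruence is then merged by
      \<open>A_iff\<close>.\<close>
    also have "\<dots> = (\<Sum>k\<in>PiE UNIV S. \<Prod>i\<in>UNIV. of_bool ([int t = shift i (k i) * int (P i (k i - 1))] (mod int (P i (k i)))))"
      using finS by (intro prod_sum_PiE) auto
    also have "\<dots> = (\<Sum>k\<in>PiE UNIV S. of_bool ([t = A k] (mod (\<Prod>i\<in>UNIV. P i (k i)))))"
      unfolding of_bool_all_eq_prod[symmetric] using A_iff by (intro sum.cong) auto
    finally have 1: "of_bool (B (M0 + t)) = (\<Sum>k\<in>PiE UNIV S. of_bool ([t = A k] (mod (\<Prod>i\<in>UNIV. P i (k i)))) :: real)" .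
    have "(\<Prod>i\<in>UNIV. y $ i) = (\<Sum>k\<in>PiE UNIV S. \<Prod>i\<in>UNIV. 1 / real (P i (k i)))"
      unfolding y_def vec_lambda_beta using finS by (intro prod_sum_PiE) auto
    then have "(\<Prod>i\<in>UNIV. y $ i) = (\<Sum>k\<in>PiE UNIV S. 1 / real (\<Prod>i\<in>UNIV. P i (k i)))"
      by (simp add: prod_dividef)
    then show ?thesis unfolding 1 by (simp only: sum_subtractf)
  qed
  have "G (M0 + M) - G M0 = (\<Sum>t=1..M. of_bool (B (M0 + t)) - (\<Prod>i\<in>UNIV. y $ i))" for M
    by (induction M) (auto simp: G_def)
  then have diff: "G (M0 + M) - G M0 = (\<Sum>k\<in>PiE UNIV S. \<Sum>t=1..M.
      of_bool ([t = A k] (mod (\<Prod>i\<in>UNIV. P i (k i)))) - 1 / real (\<Prod>i\<in>UNIV. P i (k i)))" for M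
    unfolding B_eq by (subst sum.swap) simp
  have "(\<Sum>M=1..m. G (M0 + M) - G M0) = (\<Sum>k\<in>PiE UNIV S. \<Sum>M=1..m. \<Sum>t=1..M.
      of_bool ([t = A k] (mod (\<Prod>i\<in>UNIV. P i (k i)))) - 1 / real (\<Prod>i\<in>UNIV. P i (k i)))"
    unfolding diff by (rule sum.swap)
  also have "\<dots> = (\<Sum>k\<in>PiE UNIV S. real m *
      (1/2 - real (A k) / real (\<Prod>i\<in>UNIV. P i (k i)) + 1 / (2 * real (\<Prod>i\<in>UNIV. P i (k i)))))"
  proof (intro sum.cong refl residue_class_average A)
    fix k assume k: "k \<in> PiE UNIV S"
    have "k i \<le> n" for i using PiE_mem[OF k, of i] S(1)[of i] by auto
    then show "(\<Prod>i\<in>UNIV. P i (k i)) dvd m"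
      unfolding m_def by (intro prod_dvd_prod base_facts(2))
  qed
  finally have sum_eq: "(\<Sum>M=1..m. G (M0 + M) - G M0) = real m * (\<Sum>k\<in>PiE UNIV S.
      1/2 - real (A k) / real (\<Prod>i\<in>UNIV. P i (k i)) + 1 / (2 * real (\<Prod>i\<in>UNIV. P i (k i))))" (is "_ = _ * ?W")
    by (simp only: sum_distrib_left)
  have "\<bar>\<Sum>M=1..m. G (M0 + M) - G M0\<bar> \<le> (\<Sum>M=1..m. \<bar>G (M0 + M) - G M0\<bar>)"
    by (rule sum_abs)
  also have "\<dots> \<le> (\<Sum>M=1..m. 2 * peak x N)"
  proof (intro sum_mono)
    fix M assume M: "M \<in> {1..m}"
    \<comment> \<open>Both \<open>M0\<close> and \<open>M\<close> are at most one period
      \<open>m\<close>, which explains the factor 2 in the condition on \<open>N\<close>.\<close>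
    have "M0 + M \<le> N" "M0 \<le> N" using M M0(1) N by (auto simp: m_def)
    then show "\<bar>G (M0 + M) - G M0\<bar> \<le> 2 * peak x N"
      using G_le[of "M0 + M"] G_le[of M0] by linarith
  qed
  finally have "real m * \<bar>?W\<bar> \<le> real m * (2 * peak x N)"
    unfolding sum_eq abs_mult by simp
  then show ?thesis using m_pos by (simp only: mult_le_cancel_left_pos of_nat_0_less_iff)
qed

text \<open>The assumptions \<open>pq\<close> and \<open>same\<close> describe positions left by two
  applications of the pigeonhole principle; they make the hypotheses of
  \<open>select_positions\<close> available with a constant \<open>V\<close>. The summand
  \<open>1/2\<close> absorbs the terms \<open>1 / (2 * P)\<close> of the averages.\<close>

lemma positions_le_peak:
  fixes q :: "'d \<Rightarrow> nat" and J :: "'d \<Rightarrow> nat set"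
  assumes x: "x \<in> unit_cube" and J: "\<And>i. J i \<subseteq> {1..n}" "\<And>i. J i \<noteq> {}"
    and card2: "CARD('d) \<ge> 2"
    and N: "2 * (\<Prod>i\<in>UNIV. P i n) \<le> N"
    and pq: "\<And>i j. j \<in> J i \<Longrightarrow> p i j = q i"
    and same: "\<And>i j j'. j \<in> J i \<Longrightarrow> j' \<in> J i \<Longrightarrow> [P i j = P i j'] (mod (\<Prod>l\<in>UNIV-{i}. q l))"
  shows "(\<Prod>i\<in>UNIV. real (card (J i))) / (2 ^ (CARD('d) + 1) * real (\<Prod>i\<in>UNIV. q i)) \<le> 2 * peak x N + 1/2"
proof -
  have J1: "j \<ge> 1" "j \<le> n" if "j \<in> J i" for i j using that J(1)[of i] by auto
  define j0 where "j0 i = (SOME j. j \<in> J i)" for i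
  have j0: "j0 i \<in> J i" for i unfolding j0_def using J(2) by (simp add: some_in_eq)
  have q: "q i \<ge> 2" for i
    using cantor_base.base_ge_2[OF base J1(1)[OF j0]] pq[OF j0] by metis
  have cop: "coprime (q i) (q j)" if "i \<noteq> j" for i j
    using coprime_bases[OF that J1(1)[OF j0] J1(1)[OF j0]] pq[OF j0] by metis
  interpret coprime_moduli q
    using card2 q cop by unfold_locales auto
  have q_pos: "q i > 0" for i using q[of i] by simp
  have P_split: "P i j = P i (j - 1) * q i" if "j \<in> J i" for i j
    using cantor_base.P_Suc[OF base, of i "j - 1"] J1(1)[OF that] pq[OF that] by simp
  have finJ: "finite (J i)" for i using J(1) finite_subset by blast
  have kJ: "k i \<in> J i" if "k \<in> PiE UNIV J" for k i using PiE_mem[OF that, of i] by simp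
  have nd: "\<not> int (q i) dvd shift i j" if "j \<in> J i" for i j
    using scrambled_base.digit_shift_mod[OF scrambled J1(1)[OF that]] pq[OF that] by metis
  define R where "R k r \<longleftrightarrow> r \<in> {1..<Q} \<and>
      (\<forall>t. (\<forall>i. [int t = shift i (k i) * int (P i (k i - 1))] (mod int (P i (k i)))) \<longleftrightarrow>
         [t = r * (\<Prod>i\<in>UNIV. P i (k i - 1))] (mod (\<Prod>i\<in>UNIV. P i (k i)))) \<and>
      (\<forall>i. [int (r * (\<Prod>l\<in>UNIV-{i}. P l (k l - 1))) = shift i (k i)] (mod int (q i)))" for k r
  have "\<exists>r. R k r" if k: "k \<in> PiE UNIV J" for k
  proof -
    have copP: "coprime (P i (k i - 1) * q i) (P j (k j - 1) * q j)" if "i \<noteq> j" for i j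
      using coprime_P[OF that, of "k i" "k j"] unfolding P_split[OF kJ[OF k]] .
    show ?thesis
      unfolding R_def P_split[OF kJ[OF k]]
      by (rule cofactor_residue[where m = "\<lambda>i. P i (k i - 1)" and q = q and \<delta> = "\<lambda>i. shift i (k i)",
            OF base_facts(1) q_pos copP nd[OF kJ[OF k]]])
  qed
  then obtain r where "\<And>k. k \<in> PiE UNIV J \<Longrightarrow> R k (r k)" by metis
  then have r: "r k \<in> {1..<Q}"
    "(\<forall>i. [int t = shift i (k i) * int (P i (k i - 1))] (mod int (P i (k i)))) \<longleftrightarrow>
         [t = r k * (\<Prod>i\<in>UNIV. P i (k i - 1))] (mod (\<Prod>i\<in>UNIV. P i (k i)))"
    "[int (r k * (\<Prod>l\<in>UNIV-{i}. P l (k l - 1))) = shift i (k i)] (mod int (q i))"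
    if "k \<in> PiE UNIV J" for k t i
    using that unfolding R_def by blast+
  define V where "V i = (\<Prod>l\<in>UNIV-{i}. P l (j0 l))" for i
  have V: "coprime (V i) (q i)" for i
    unfolding V_def
  proof (rule prod_coprime_left)
    fix l assume "l \<in> UNIV - {i}"
    then have "coprime (P l (j0 l)) (P i (j0 i))" by (intro coprime_P) auto
    then show "coprime (P l (j0 l)) (q i)" unfolding P_split[OF j0[of i]] by simp
  qed
  \<comment> \<open>Passing from \<open>P l (k l - 1)\<close> to \<open>P l (k l)\<close> for all
    \<open>l\<close> other than \<open>i\<close> multiplies by \<open>cofactor i\<close>. By
    \<open>same\<close>, the resulting product may be replaced modulo \<open>q i\<close> by
    \<open>V i\<close>, which does not depend on \<open>k\<close>.\<close>
  have cong: "[int (r k * V i) = shift i (k i) * int (cofactor i)] (mod int (q i))"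
    if k: "k \<in> PiE UNIV J" for k i
  proof -
    have "[P l (k l) = P l (j0 l)] (mod q i)" if "l \<in> UNIV - {i}" for l
    proof (rule cong_dvd_modulus_nat[OF same[OF kJ[OF k] j0]])
      show "q i dvd (\<Prod>l'\<in>UNIV-{l}. q l')" using that by (intro dvd_prodI) auto
    qed
    then have "[(\<Prod>l\<in>UNIV-{i}. P l (k l)) = V i] (mod q i)"
      unfolding V_def by (intro cong_prod) auto
    then have "[r k * V i = r k * (\<Prod>l\<in>UNIV-{i}. P l (k l))] (mod q i)"
      by (intro cong_mult cong_refl) (simp add: cong_sym)
    also have "(\<Prod>l\<in>UNIV-{i}. P l (k l)) = (\<Prod>l\<in>UNIV-{i}. P l (k l - 1)) * cofactor i"
      unfolding P_split[OF kJ[OF k]] by (rule prod.distrib)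
    finally have "[int (r k * V i) = int (r k * (\<Prod>l\<in>UNIV-{i}. P l (k l - 1))) * int (cofactor i)] (mod int (q i))"
      unfolding of_nat_mult[symmetric] cong_int_iff by (simp only: mult.assoc)
    also have "[int (r k * (\<Prod>l\<in>UNIV-{i}. P l (k l - 1))) * int (cofactor i) = shift i (k i) * int (cofactor i)] (mod int (q i))"
      using r(3)[OF k] by (intro cong_mult cong_refl)
    finally show ?thesis .
  qed
  obtain S where S: "\<And>i. S i \<subseteq> J i" "\<And>i. S i \<noteq> {}"
    "\<bar>\<Sum>k\<in>PiE UNIV S. 1/2 - real (r k) / real Q\<bar> \<ge> (\<Prod>i\<in>UNIV. real (card (J i))) / (2 ^ (CARD('d) + 1) * real Q)"
  proof (rule select_positions[where J = J and \<delta> = shift and r = r and V = V])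
    show "r k < Q" if "k \<in> PiE UNIV J" for k using r(1)[OF that] by simp
  qed (use finJ J(2) cong V nd in auto)
  have sub: "k \<in> PiE UNIV J" if "k \<in> PiE UNIV S" for k
    using that S(1) by (auto simp: PiE_def Pi_def)
  define A where "A k = r k * (\<Prod>i\<in>UNIV. P i (k i - 1))" for k
  have P_prod: "(\<Prod>i\<in>UNIV. P i (k i)) = Q * (\<Prod>i\<in>UNIV. P i (k i - 1))" if "k \<in> PiE UNIV J" for k
    unfolding P_split[OF kJ[OF that]] prod.distrib by (rule mult.commute)
  have pos: "(\<Prod>i\<in>UNIV. P i (f i)) > 0" for f using base_facts(1) by simp
  have "\<bar>\<Sum>k\<in>PiE UNIV S. 1/2 - real (A k) / real (\<Prod>i\<in>UNIV. P i (k i)) + 1 / (2 * real (\<Prod>i\<in>UNIV. P i (k i)))\<bar>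
      \<le> 2 * peak x N"
  proof (rule average_le_peak[OF x _ S(2) N])
    show "S i \<subseteq> {1..n}" for i using S(1) J(1) by blast
    show "A k \<in> {1..\<Prod>i\<in>UNIV. P i (k i)}" if "k \<in> PiE UNIV S" for k
    proof -
      have "1 \<le> r k" "r k \<le> Q" using r(1)[OF sub[OF that]] by auto
      then show ?thesis
        unfolding P_prod[OF sub[OF that]] A_def using pos[of "\<lambda>i. k i - 1"]
        by (simp only: atLeastAtMost_iff mult_le_mono1) (metis One_nat_def Suc_leI mult_pos_pos less_le_trans zero_less_one)
    qed
    show "(\<forall>i. [int t = shift i (k i) * int (P i (k i - 1))] (mod int (P i (k i)))) \<longleftrightarrow>
      [t = A k] (mod (\<Prod>i\<in>UNIV. P i (k i)))" if "k \<in> PiE UNIV S" for k t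
      unfolding A_def by (rule r(2)[OF sub[OF that]])
  qed
  moreover have "real (A k) / real (\<Prod>i\<in>UNIV. P i (k i)) = real (r k) / real Q" if "k \<in> PiE UNIV S" for k
  proof -
    have "real (a * c) / real (b * c) = real a / real b" if "c > 0" for a b c :: nat using that by simp
    from this[OF pos] show ?thesis unfolding P_prod[OF sub[OF that]] A_def .
  qed
  then have "(\<Sum>k\<in>PiE UNIV S. 1/2 - real (A k) / real (\<Prod>i\<in>UNIV. P i (k i)) + 1 / (2 * real (\<Prod>i\<in>UNIV. P i (k i)))) =
      (\<Sum>k\<in>PiE UNIV S. 1/2 - real (r k) / real Q) + (\<Sum>k\<in>PiE UNIV S. 1 / (2 * real (\<Prod>i\<in>UNIV. P i (k i))))"
    unfolding sum.distrib[symmetric] by (intro sum.cong) simp_all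
  moreover have "0 \<le> (\<Sum>k\<in>PiE UNIV S. 1 / (2 * real (\<Prod>i\<in>UNIV. P i (k i))))"
    by (intro sum_nonneg divide_nonneg_nonneg) (auto intro!: prod_nonneg)
  \<comment> \<open>The sum factors into half the product of the coordinates of the corner, all of
    which are below 1.\<close>
  moreover have "(\<Sum>k\<in>PiE UNIV S. 1 / (2 * real (\<Prod>i\<in>UNIV. P i (k i)))) \<le> 1/2"
  proof -
    have S_sub: "S i \<subseteq> {1..n}" for i using S(1) J(1) by blast
    have "(\<Sum>k\<in>PiE UNIV S. 1 / (2 * real (\<Prod>i\<in>UNIV. P i (k i)))) =
        1/2 * (\<Sum>k\<in>PiE UNIV S. \<Prod>i\<in>UNIV. 1 / real (P i (k i)))"
      by (simp add: sum_distrib_left prod_dividef)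
    also have "(\<Sum>k\<in>PiE UNIV S. \<Prod>i\<in>UNIV. 1 / real (P i (k i))) = (\<Prod>i\<in>UNIV. \<Sum>j\<in>S i. 1 / real (P i j))"
      using finite_subset[OF S(1) finJ] by (intro prod_sum_PiE[symmetric]) auto
    also have "\<dots> \<le> 1"
      using less_imp_le[OF cantor_base.tail_marks_less_1[OF base S_sub]]
      by (intro prod_le_1) (auto intro!: sum_nonneg)
    finally show ?thesis by simp
  qed
  ultimately show ?thesis using S(3) by linarith
qed

end

text \<open>Here \<open>m / a\<close> is at least \<open>Z - 1/4\<close>. As \<open>Z\<close> is at
  least \<open>2 * s\<close>, Bernoulli's inequality keeps \<open>7/8\<close> of
  \<open>Z ^ s\<close>, and \<open>7/16 - 1/4\<close> of \<open>Z ^ s\<close> outweighs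
  \<open>1/2\<close> because \<open>Z ^ s\<close> is at least 4.\<close>

lemma power_rounding_loss:
  fixes Z a m :: real
  assumes s: "s \<ge> 2" and a: "a \<ge> 8" and Z: "Z \<ge> 2 ^ s" and m: "m \<ge> a * Z - 2"
  shows "Z ^ s / 4 \<le> (m / a) ^ s / 2 - 1/2"
proof -
  have s_le: "2 * real s \<le> 2 ^ s"
    using s
  proof (induction s rule: dec_induct)
    case (step s)
    have "2 * real (Suc s) \<le> 2 * (2 * real s)" using step.hyps by simp
    also have "\<dots> \<le> 2 * 2 ^ s" using step.IH by simp
    finally show ?case by simp
  qed simp
  have "(2::real) ^ 2 \<le> 2 ^ s" using s by (intro power_increasing) auto
  then have Z4: "Z \<ge> 4" using Z by simp
  have ge: "Z ^ s \<ge> 4"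
    using power_increasing[of 1 s Z] s Z4 by simp
  have "1 - 1 / (4 * Z) \<ge> 0" using Z4 by (simp add: field_simps)
  moreover have "Z * (1 - 1 / (4 * Z)) \<le> m / a"
  proof -
    have "Z * (1 - 1 / (4 * Z)) = Z - 1/4" using Z4 by (simp add: field_simps)
    also have "\<dots> \<le> Z - 2 / a" using a by (simp add: field_simps)
    also have "\<dots> = (a * Z - 2) / a" using a by (simp add: field_simps)
    also have "\<dots> \<le> m / a" using m a by (intro divide_right_mono) auto
    finally show ?thesis .
  qed
  ultimately have "(Z * (1 - 1 / (4 * Z))) ^ s \<le> (m / a) ^ s"
    using Z4 by (intro power_mono mult_nonneg_nonneg) auto
  then have 1: "Z ^ s * (1 - 1 / (4 * Z)) ^ s \<le> (m / a) ^ s" by (simp only: power_mult_distrib)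
  have "real s / (4 * Z) \<le> 1/8"
    using s_le Z Z4 by (simp add: field_simps)
  then have "7/8 \<le> 1 + real s * (- (1 / (4 * Z)))" by simp
  also have "\<dots> \<le> (1 + - (1 / (4 * Z))) ^ s"
    using Z4 by (intro Bernoulli_inequality) (simp add: field_simps)
  finally have "Z ^ s * (7/8) \<le> Z ^ s * (1 - 1 / (4 * Z)) ^ s"
    using ge by (intro mult_left_mono) auto
  then show ?thesis using 1 ge by linarith
qed

theorem mainTheorem1:
  fixes s h\<^sub>0 q\<^sub>0 N :: nat
    and h :: "'d::finite \<Rightarrow> nat"
    and q p :: "'d \<Rightarrow> nat \<Rightarrow> nat"
    and \<sigma> :: "'d \<Rightarrow> nat \<Rightarrow> nat \<Rightarrow> nat"
    and C\<^sub>1 C :: real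
  assumes "s = CARD('d)" and "s \<ge> 2"
    and "\<And>i. h i \<ge> 1"
    and "\<And>i k. k \<in> {1..h i} \<Longrightarrow> q i k \<ge> 2"
    and "\<And>i j k l. i \<noteq> j \<Longrightarrow> k \<in> {1..h i} \<Longrightarrow> l \<in> {1..h j} \<Longrightarrow> gcd (q i k) (q j l) = 1"
    and "\<And>i j. j \<ge> 1 \<Longrightarrow> p i j \<in> q i ` {1..h i}"
    and "\<And>i j. j \<ge> 1 \<Longrightarrow> bij_betw (\<sigma> i j) {0..p i j - 1} {0..p i j - 1}"
    and "h\<^sub>0 = Max (range h)"
    and "q\<^sub>0 = Max {q i j | i j. j \<in> {1..h i}}"
    and "C\<^sub>1 = 2 * real s * real h\<^sub>0 * real q\<^sub>0 ^ s * log 2 (real q\<^sub>0)"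
    and "C = 2 ^ (s + 3) * real s ^ s * real h\<^sub>0 ^ s * real q\<^sub>0 ^ (s\<^sup>2) * log 2 (real q\<^sub>0) ^ s"
    and "log 2 (real N) \<ge> 2 * real q\<^sub>0 ^ (s - 1) * C\<^sub>1"
  shows "(INF x\<in>(unit_cube :: (real ^ 'd) set).
            Max ((\<lambda>M. real M * star_discrepancy (\<lambda>n. halton p \<sigma> n x) M) ` {1..N}))
         \<ge> inverse C * log 2 (real N) ^ s"
proof -
  have p_ge: "p i j \<ge> 2" if "j \<ge> 1" for i j
    using assms(6)[OF that, of i] assms(4) by auto
  interpret halton_bases p \<sigma>
  proof
    show "p i j \<ge> 2" if "j \<ge> 1" for i j using p_ge[OF that] .
    show "bij_betw (\<sigma> i j) {0..p i j - 1} {0..p i j - 1}" if "j \<ge> 1" for i j using assms(7)[OF that] .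
    show "coprime (p i a) (p j b)" if ij: "i \<noteq> j" "a \<ge> 1" "b \<ge> 1" for i j a b
    proof -
      obtain k l where "k \<in> {1..h i}" "p i a = q i k" "l \<in> {1..h j}" "p j b = q j l"
        using assms(6)[OF ij(2), of i] assms(6)[OF ij(3), of j] by auto
      then show ?thesis using assms(5)[OF ij(1)] by (simp add: coprime_iff_gcd_eq_1)
    qed
  qed
  have fin_q: "finite {q i j | i j. j \<in> {1..h i}}"
  proof -
    have "{q i j | i j. j \<in> {1..h i}} = (\<Union>i. q i ` {1..h i})" by blast
    then show ?thesis by simp
  qed
  have p_le: "p i j \<le> q\<^sub>0" if "j \<ge> 1" for i j
    unfolding assms(9) using assms(6)[OF that, of i] by (intro Max_ge fin_q) blast
  have h_le: "h i \<le> h\<^sub>0" for i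
    unfolding assms(8) by (intro Max_ge) auto
  have q0: "q\<^sub>0 \<ge> 2" using p_ge[of 1 undefined] p_le[of 1 undefined] by simp
  have h0: "h\<^sub>0 \<ge> 1" using assms(3)[of undefined] h_le[of undefined] by simp
  define L where "L = log 2 (real N)"
  define lg where "lg = log 2 (real q\<^sub>0)"
  define Z where "Z = L / C\<^sub>1"
  \<comment> \<open>Chosen so that \<open>C\<^sub>1 = a * (s * lg)\<close>; thus
    \<open>a * Z\<close> is \<open>L / (s * lg)\<close>, the number of usable positions up to
    rounding.\<close>
  define a where "a = 2 * real h\<^sub>0 * real q\<^sub>0 ^ s"
  \<comment> \<open>The largest \<open>n\<close> with \<open>2 * q\<^sub>0 ^ (n * s)\<close> at most
    \<open>N\<close>, which makes two full periods fit into the available time.\<close>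
  define n where "n = nat \<lfloor>(L - 1) / (real s * lg)\<rfloor>"
  have lg: "lg \<ge> 1" unfolding lg_def using q0 by (simp add: le_log_iff)
  have slg: "real s * lg \<ge> 1"
    using mult_mono[of 1 "real s" 1 lg] lg assms(2) by simp
  have "(2::real) ^ 2 \<le> 2 ^ s" using assms(2) by (intro power_increasing) auto
  also have "\<dots> \<le> real q\<^sub>0 ^ s" using q0 by (intro power_mono) auto
  finally have "4 \<le> real q\<^sub>0 ^ s" by simp
  then have a: "a \<ge> 8"
    unfolding a_def using mult_mono[of 1 "real h\<^sub>0" 4 "real q\<^sub>0 ^ s"] h0 by simp
  have C1: "C\<^sub>1 = a * (real s * lg)"
    unfolding assms(10) a_def lg_def by simp
  have C1_ge: "C\<^sub>1 \<ge> 8"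
    unfolding C1 using mult_mono[OF a slg] a by simp
  \<comment> \<open>This is the assumed lower bound on \<open>log 2 N\<close>; its purpose is to
    give \<open>Z\<close> at least \<open>2 ^ s\<close>.\<close>
  have "2 * real q\<^sub>0 ^ (s - 1) \<le> Z"
    unfolding Z_def L_def using assms(12) C1_ge by (simp add: le_divide_eq)
  moreover have "2 ^ s \<le> 2 * real q\<^sub>0 ^ (s - 1)"
  proof -
    have "(2::real) ^ (s - 1) \<le> real q\<^sub>0 ^ (s - 1)" using q0 by (intro power_mono) auto
    moreover have "(2::real) ^ s = 2 * 2 ^ (s - 1)"
      using assms(2) by (metis Suc_1 Suc_le_lessD less_imp_Suc_add diff_Suc_1 power_Suc)
    ultimately show ?thesis by simp
  qed
  ultimately have Z: "2 ^ s \<le> Z" by linarith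
  then have "Z \<ge> 4" using \<open>(2::real) ^ 2 \<le> 2 ^ s\<close> by simp
  have L: "L = Z * C\<^sub>1" using C1_ge by (simp add: Z_def)
  have "L \<ge> 1"
    unfolding L using mult_mono[of 1 Z 1 C\<^sub>1] \<open>Z \<ge> 4\<close> C1_ge by simp
  have aZ: "a * Z = L / (real s * lg)"
    unfolding Z_def C1 using a slg by simp
  have n_ge: "real n \<ge> a * Z - 2"
  proof -
    have "real n > (L - 1) / (real s * lg) - 1" unfolding n_def by linarith
    moreover have "(L - 1) / (real s * lg) = a * Z - 1 / (real s * lg)"
      unfolding aZ by (simp add: diff_divide_distrib)
    moreover have "1 / (real s * lg) \<le> 1" using slg by simp
    ultimately show ?thesis by linarith
  qed
  have "real n \<ge> 1"
    using n_ge mult_mono[OF a \<open>Z \<ge> 4\<close>] a by simp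
  have n_le: "real n * (real s * lg) \<le> L - 1"
  proof -
    have "real n \<le> (L - 1) / (real s * lg)"
      unfolding n_def using \<open>L \<ge> 1\<close> slg by (simp add: of_nat_nat)
    then show ?thesis using slg by (simp add: pos_le_divide_eq)
  qed
  have N_bound: "2 * (\<Prod>i\<in>UNIV. P i n) \<le> N"
  proof -
    have "P i n \<le> q\<^sub>0 ^ n" for i
    proof -
      have "(\<Prod>k=1..n. p i k) \<le> (\<Prod>k=1..n. q\<^sub>0)" using p_le by (intro prod_mono) auto
      then show ?thesis by (simp add: cantor_prod_def)
    qed
    then have "(\<Prod>i\<in>UNIV. P i n) \<le> (\<Prod>i\<in>(UNIV::'d set). q\<^sub>0 ^ n)"
      by (intro prod_mono) auto
    then have "real (2 * (\<Prod>i\<in>UNIV. P i n)) \<le> real (2 * q\<^sub>0 ^ (n * s))"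
      unfolding of_nat_le_iff by (simp add: assms(1) power_mult)
    also have "\<dots> = 2 powr (1 + real n * (real s * lg))"
    proof -
      have "real (q\<^sub>0 ^ (n * s)) = real q\<^sub>0 powr (real n * real s)"
        using q0 by (simp add: powr_realpow flip: of_nat_mult)
      also have "\<dots> = (2 powr lg) powr (real n * real s)"
        unfolding lg_def using q0 by simp
      also have "\<dots> = 2 powr (real n * (real s * lg))"
        by (simp add: powr_powr mult_ac)
      finally show ?thesis by (simp add: powr_add)
    qed
    also have "\<dots> \<le> 2 powr L"
      using n_le by (intro powr_mono) auto
    also have "\<dots> = real N"
    proof -
      \<comment> \<open>The logarithm of 0 has the value 0, so \<open>L\<close> being at least 1
        excludes \<open>N = 0\<close>.\<close>
      have "N \<noteq> 0" using \<open>L \<ge> 1\<close> unfolding L_def by (intro notI) (simp add: log_def)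
      then show ?thesis unfolding L_def by simp
    qed
    finally show ?thesis unfolding of_nat_le_iff .
  qed
  \<comment> \<open>First pigeonhole: coordinate \<open>i\<close> has at most \<open>h i\<close>
    different bases, so one of them fills at least a fraction \<open>1 / h\<^sub>0\<close> of the
    positions.\<close>
  have "\<exists>b. card {1..n} \<le> h\<^sub>0 * card {j\<in>{1..n}. p i j = b}" for i
  proof (rule pigeonhole_fiber)
    show "(\<lambda>j. p i j) \<in> {1..n} \<rightarrow> q i ` {1..h i}" using assms(6) by auto
    have "card (q i ` {1..h i}) \<le> h i" using card_image_le[of "{1..h i}" "q i"] by simp
    then show "card (q i ` {1..h i}) \<le> h\<^sub>0" using h_le[of i] by simp
  qed auto
  then obtain b where b: "\<And>i. n \<le> h\<^sub>0 * card {j\<in>{1..n}. p i j = b i}"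
    unfolding card_atLeastAtMost by (metis diff_Suc_1)
  define D where "D i = {j\<in>{1..n}. p i j = b i}" for i
  have D: "n \<le> h\<^sub>0 * card (D i)" for i using b by (simp add: D_def)
  have b_bounds: "2 \<le> b i" "b i \<le> q\<^sub>0" for i
  proof -
    have "card (D i) \<noteq> 0" using D[of i] \<open>real n \<ge> 1\<close> by (intro notI) simp
    then obtain j where "j \<in> D i" by (metis card.empty ex_in_conv)
    then show "2 \<le> b i" "b i \<le> q\<^sub>0" using p_ge[of j i] p_le[of j i] by (auto simp: D_def)
  qed
  define cof where "cof i = (\<Prod>l\<in>UNIV-{i}. b l)" for i
  have b_pos: "b i > 0" for i using b_bounds(1)[of i] by simp
  have cof_pos: "cof i > 0" for i using b_pos by (simp add: cof_def)
  \<comment> \<open>Second pigeonhole: fix the residue of \<open>P i j\<close> modulo the product of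
    the bases chosen in the other coordinates.\<close>
  have "\<exists>c. card (D i) \<le> cof i * card {j\<in>D i. P i j mod cof i = c}" for i
    using cof_pos by (intro pigeonhole_fiber[where B = "{..<cof i}"]) (auto simp: D_def)
  then obtain c where c: "\<And>i. card (D i) \<le> cof i * card {j\<in>D i. P i j mod cof i = c i}" by metis
  define J where "J i = {j\<in>D i. P i j mod cof i = c i}" for i
  have n_J: "n \<le> h\<^sub>0 * (cof i * card (J i))" for i
    using D[of i] mult_le_mono2[OF c[of i], of "h\<^sub>0"] unfolding J_def by linarith
  have J_ne: "J i \<noteq> {}" for i
    using n_J[of i] \<open>real n \<ge> 1\<close> by (intro notI) simp
  define Q where "Q = (\<Prod>i\<in>UNIV. b i)"
  have Q_pos: "Q > 0" using b_pos by (simp add: Q_def)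
  have bound: "(\<Prod>i\<in>UNIV. real (card (J i))) / (2 ^ (s + 1) * real Q) \<le> 2 * peak x N + 1/2"
    if "x \<in> unit_cube" for x
    unfolding Q_def assms(1)
    by (rule positions_le_peak[where n = n])
       (use that J_ne N_bound assms(1,2) in \<open>auto simp: J_def D_def cof_def cong_def\<close>)
  \<comment> \<open>The losses \<open>cof i\<close> multiply to \<open>Q ^ (s - 1)\<close>. With the
    further factor \<open>Q\<close> from the denominator the total loss is
    \<open>h\<^sub>0 ^ s * Q ^ s\<close>, at most
    \<open>(h\<^sub>0 * q\<^sub>0 ^ s) ^ s = (a / 2) ^ s\<close>.\<close>
  have "(real n / a) ^ s / 2 \<le> (\<Prod>i\<in>UNIV. real (card (J i))) / (2 ^ (s + 1) * real Q)"
  proof -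
    define K where "K = (\<Prod>i\<in>UNIV. card (J i))"
    have "Q = b i * cof i" for i by (simp add: Q_def cof_def prod.remove)
    then have "(\<Prod>i\<in>(UNIV::'d set). b i * cof i) = Q ^ s"
      by (metis (no_types, lifting) assms(1) prod.cong prod_constant)
    then have cof_prod: "Q * (\<Prod>i\<in>UNIV. cof i) = Q ^ s"
      by (simp add: prod.distrib Q_def)
    have "n ^ s = (\<Prod>i\<in>(UNIV::'d set). n)" by (simp add: assms(1))
    also have "\<dots> \<le> (\<Prod>i\<in>UNIV. h\<^sub>0 * (cof i * card (J i)))"
      using n_J by (intro prod_mono) auto
    also have "\<dots> = h\<^sub>0 ^ s * ((\<Prod>i\<in>UNIV. cof i) * K)"
      by (simp add: prod.distrib assms(1) K_def)
    finally have "n ^ s * Q \<le> h\<^sub>0 ^ s * ((\<Prod>i\<in>UNIV. cof i) * K) * Q" by (rule mult_le_mono1)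
    also have "\<dots> = h\<^sub>0 ^ s * Q ^ s * K" unfolding cof_prod[symmetric] by (simp add: mult_ac)
    also have "\<dots> \<le> h\<^sub>0 ^ s * (q\<^sub>0 ^ s) ^ s * K"
    proof -
      have "Q \<le> (\<Prod>i\<in>(UNIV::'d set). q\<^sub>0)"
        unfolding Q_def using b_bounds(2) by (intro prod_mono) auto
      then have "Q \<le> q\<^sub>0 ^ s" by (simp add: assms(1))
      then show ?thesis by (intro mult_le_mono power_mono) auto
    qed
    finally have "real (n ^ s * Q) \<le> real (h\<^sub>0 ^ s * (q\<^sub>0 ^ s) ^ s * K)"
      unfolding of_nat_le_iff .
    then have "real n ^ s * real Q \<le> (real h\<^sub>0 * real q\<^sub>0 ^ s) ^ s * real K"
      by (simp add: power_mult_distrib)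
    moreover have "real h\<^sub>0 * real q\<^sub>0 ^ s = a / 2" by (simp add: a_def)
    ultimately have "real n ^ s * real Q \<le> a ^ s / 2 ^ s * real K" by (simp add: power_divide)
    moreover have "real Q > 0" using Q_pos by simp
    moreover have "a ^ s > 0" using a by simp
    ultimately have "(real n / a) ^ s / 2 \<le> real K / (2 ^ (s + 1) * real Q)"
      by (simp add: power_divide field_simps)
    then show ?thesis by (simp add: K_def)
  qed
  moreover have "Z ^ s / 4 \<le> (real n / a) ^ s / 2 - 1/2"
    by (rule power_rounding_loss[OF assms(2) a Z n_ge])
  ultimately have peak_ge: "Z ^ s / 8 \<le> peak x N" if "x \<in> unit_cube" for x
    using bound[OF that] by linarith
  \<comment> \<open>\<open>C\<close> equals \<open>8 * C\<^sub>1 ^ s\<close>: a factor 4 comes from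
    rounding and a factor 2 from comparing two times in the average.\<close>
  have C_eq: "inverse C * L ^ s = Z ^ s / 8"
  proof -
    have "C = 8 * C\<^sub>1 ^ s"
      unfolding assms(10,11) by (simp add: power_mult_distrib power_add power2_eq_square power_mult)
    moreover have "C\<^sub>1 ^ s \<noteq> 0" using C1_ge by simp
    ultimately show ?thesis unfolding L by (simp add: power_mult_distrib field_simps)
  qed
  have "(0 :: real ^ 'd) \<in> unit_cube" by (simp add: unit_cube_def)
  then have "(unit_cube :: (real ^ 'd) set) \<noteq> {}" by blast
  then show ?thesis
    unfolding L_def[symmetric] C_eq by (rule cINF_greatest[OF _ peak_ge[unfolded peak_def]])
qed

end
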